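(* Let $\mathcal G$ be a non-empty ample groupoid (not necessarily Hausdorff) and let $K$ be a field. Then the Steinberg algebra $K\mathcal G$ is simple if and only if $\mathcal G$ is minimal, $\mathcal G$ is effective, and the ideal of singular functions of $K\mathcal G$ is zero.
   Context: A groupoid $\mathcal G$ is identified with its set of arrows; $\mathcal G^0\subseteq\mathcal G$ is the set of identities (unit space), $d,r:\mathcal G\to\mathcal G^0$ are the domain and range maps, and $\alpha\beta$ is defined when $d(\alpha)=r(\beta)$. A topological groupoid (domain, range, multiplication and inversion continuous, $\mathcal G^0$ with the subspace topology) is étale if $d$ is a local homeomorphism; $\mathcal G^0$ is always assumed locally compact Hausdorff, but $\mathcal G$ need not be Hausdorff. It is ample if moreover $\mathcal G^0$ has a basis of compact open sets. A local bisection is an open set $U\subseteq\mathcal G$ such that $d|_U$ and $r|_U$ are homeomorphisms onto their images. Steinberg algebra: for a commutative unital ring $K$, $K\mathcal G$ is the $K$-span in $K^{\mathcal G}$ of the characteristic functions $\chi_U$ of compact local bisections $U$, with convolution $(f*g)(\gamma)=\sum_{\alpha\beta=\gamma}f(\alpha)g(\beta)$. A function $f\in K\mathcal G$ is singular if $\operatorname{supp}(f)=f^{-1}(K\setminus\{0\})$ (no closure taken) has empty interior in $\mathcal G$. The singular functions form a two-sided ideal of $K\mathcal G$. The orbit of $x\in\mathcal G^0$ is $\{r(g): g\in\mathcal G,\ d(g)=x\}$. $\mathcal G$ is minimal if every orbit is dense in $\mathcal G^0$. The isotropy subgroupoid is $\mathrm{Iso}(\mathcal G)=\{g: d(g)=r(g)\}$;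 $\mathcal G$ is effective if the interior of $\mathrm{Iso}(\mathcal G)$ equals $\mathcal G^0$. An algebra is simple if it is non-zero and has no two-sided ideals other than $0$ and itself. *)

theory Defs
  imports "HOL-Analysis.Analysis" "HOL-Library.Function_Algebras"
begin

section \<open>Groupoids\<close>

text \<open>
  A groupoid is identified with its set of arrows, which is the carrier \<open>topspace (gtop G)\<close>
  of a topology on a subset of the type \<open>'a\<close>.  The operations are unconstrained outside
  the carrier, and \<open>gmult\<close> is unconstrained on pairs that are not composable.
\<close>

record 'a tgroupoid =
  gtop :: "'a topology"
  gdom :: "'a \<Rightarrow> 'a"
  grng :: "'a \<Rightarrow> 'a"
  gmult :: "'a \<Rightarrow> 'a \<Rightarrow> 'a"
  ginv :: "'a \<Rightarrow> 'a"

definition arrows :: "'a tgroupoid \<Rightarrow> 'a set" where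
  "arrows G = topspace (gtop G)"

definition units :: "'a tgroupoid \<Rightarrow> 'a set" where
  "units G = gdom G ` arrows G"

definition unit_space :: "'a tgroupoid \<Rightarrow> 'a topology" where
  "unit_space G = subtopology (gtop G) (units G)"

definition composable :: "'a tgroupoid \<Rightarrow> ('a \<times> 'a) set" where
  "composable G = {(a, b). a \<in> arrows G \<and> b \<in> arrows G \<and> gdom G a = grng G b}"

locale groupoid =
  fixes G :: "'a tgroupoid"
  assumes dom_closed: "a \<in> arrows G \<Longrightarrow> gdom G a \<in> arrows G"
    and rng_closed: "a \<in> arrows G \<Longrightarrow> grng G a \<in> arrows G"
    and mult_closed: "(a, b) \<in> composable G \<Longrightarrow> gmult G a b \<in> arrows G"
    and inv_closed: "a \<in> arrows G \<Longrightarrow> ginv G a \<in> arrows G"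
    and dom_dom: "a \<in> arrows G \<Longrightarrow> gdom G (gdom G a) = gdom G a"
    and rng_dom: "a \<in> arrows G \<Longrightarrow> grng G (gdom G a) = gdom G a"
    and dom_rng: "a \<in> arrows G \<Longrightarrow> gdom G (grng G a) = grng G a"
    and rng_rng: "a \<in> arrows G \<Longrightarrow> grng G (grng G a) = grng G a"
    and dom_mult: "(a, b) \<in> composable G \<Longrightarrow> gdom G (gmult G a b) = gdom G b"
    and rng_mult: "(a, b) \<in> composable G \<Longrightarrow> grng G (gmult G a b) = grng G a"
    and mult_assoc: "(a, b) \<in> composable G \<Longrightarrow> (b, c) \<in> composable G \<Longrightarrow>
          gmult G (gmult G a b) c = gmult G a (gmult G b c)"
    and mult_dom: "a \<in> arrows G \<Longrightarrow> gmult G a (gdom G a) = a"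
    and rng_mult_left: "a \<in> arrows G \<Longrightarrow> gmult G (grng G a) a = a"
    and dom_inv: "a \<in> arrows G \<Longrightarrow> gdom G (ginv G a) = grng G a"
    and rng_inv: "a \<in> arrows G \<Longrightarrow> grng G (ginv G a) = gdom G a"
    and inv_mult: "a \<in> arrows G \<Longrightarrow> gmult G (ginv G a) a = gdom G a"
    and mult_inv: "a \<in> arrows G \<Longrightarrow> gmult G a (ginv G a) = grng G a"

locale topological_groupoid = groupoid +
  assumes continuous_dom: "continuous_map (gtop G) (unit_space G) (gdom G)"
    and continuous_rng: "continuous_map (gtop G) (unit_space G) (grng G)"
    and continuous_mult:
      "continuous_map (subtopology (prod_topology (gtop G) (gtop G)) (composable G)) (gtop G)
         (\<lambda>(a, b). gmult G a b)"
    and continuous_inv: "continuous_map (gtop G) (gtop G) (ginv G)"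

definition local_homeomorphism_map :: "'a topology \<Rightarrow> 'b topology \<Rightarrow> ('a \<Rightarrow> 'b) \<Rightarrow> bool" where
  "local_homeomorphism_map X Y f \<longleftrightarrow>
     (\<forall>x\<in>topspace X. \<exists>U. openin X U \<and> x \<in> U \<and> openin Y (f ` U) \<and>
        homeomorphic_map (subtopology X U) (subtopology Y (f ` U)) f)"

locale etale_groupoid = topological_groupoid +
  assumes locally_compact_units: "locally_compact_space (unit_space G)"
    and Hausdorff_units: "Hausdorff_space (unit_space G)"
    and local_homeomorphism_dom: "local_homeomorphism_map (gtop G) (unit_space G) (gdom G)"

locale ample_groupoid = etale_groupoid +
  assumes compact_open_base:
    "\<exists>\<B>. (\<forall>B\<in>\<B>. openin (unit_space G) B \<and> compactin (unit_space G) B) \<and>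
         openin (unit_space G) = arbitrary union_of (\<lambda>B. B \<in> \<B>)"

definition local_bisection :: "'a tgroupoid \<Rightarrow> 'a set \<Rightarrow> bool" where
  "local_bisection G U \<longleftrightarrow> openin (gtop G) U \<and>
     homeomorphic_map (subtopology (gtop G) U) (subtopology (unit_space G) (gdom G ` U)) (gdom G) \<and>
     homeomorphic_map (subtopology (gtop G) U) (subtopology (unit_space G) (grng G ` U)) (grng G)"

definition orbit :: "'a tgroupoid \<Rightarrow> 'a \<Rightarrow> 'a set" where
  "orbit G x = {grng G g | g. g \<in> arrows G \<and> gdom G g = x}"

definition minimal_groupoid :: "'a tgroupoid \<Rightarrow> bool" where
  "minimal_groupoid G \<longleftrightarrow> (\<forall>x\<in>units G. unit_space G closure_of orbit G x = units G)"

definition isotropy :: "'a tgroupoid \<Rightarrow> 'a set" where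
  "isotropy G = {g \<in> arrows G. gdom G g = grng G g}"

definition effective_groupoid :: "'a tgroupoid \<Rightarrow> bool" where
  "effective_groupoid G \<longleftrightarrow> gtop G interior_of isotropy G = units G"


section \<open>Steinberg algebras\<close>

definition fun_scale :: "'k::comm_ring_1 \<Rightarrow> ('a \<Rightarrow> 'k) \<Rightarrow> 'a \<Rightarrow> 'k" where
  "fun_scale c f = (\<lambda>x. c * f x)"

global_interpretation fun_module: module "fun_scale :: 'k::comm_ring_1 \<Rightarrow> ('a \<Rightarrow> 'k) \<Rightarrow> 'a \<Rightarrow> 'k"
  by unfold_locales (auto simp: fun_scale_def algebra_simps)

text \<open>
  Functions on the groupoid are represented by functions on the whole type that vanish
  outside the arrows; this holds for every indicator function of a local bisection and
  hence for their span.
\<close>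

definition steinberg_algebra :: "'a tgroupoid \<Rightarrow> ('a \<Rightarrow> 'k::comm_ring_1) set" where
  "steinberg_algebra G =
     fun_module.span {indicator U | U. local_bisection G U \<and> compactin (gtop G) U}"

text \<open>
  For elements of the Steinberg algebra of an ample groupoid only finitely many terms of
  the convolution sum at a given arrow are non-zero.  The index set is restricted to these
  terms because \<open>sum\<close> over an infinite index set is \<open>0\<close> by convention.
\<close>

definition convolution ::
    "'a tgroupoid \<Rightarrow> ('a \<Rightarrow> 'k::comm_ring_1) \<Rightarrow> ('a \<Rightarrow> 'k) \<Rightarrow> 'a \<Rightarrow> 'k" where
  "convolution G f g = (\<lambda>c.
     \<Sum>(a, b) \<in> {(a, b) \<in> composable G. gmult G a b = c \<and> f a * g b \<noteq> 0}. f a * g b)"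

definition singular_functions :: "'a tgroupoid \<Rightarrow> ('a \<Rightarrow> 'k::comm_ring_1) set" where
  "singular_functions G = {f \<in> steinberg_algebra G. gtop G interior_of {x. f x \<noteq> 0} = {}}"

text \<open>
  Ideals and simplicity of an algebra \<open>A\<close> (not necessarily unital) consisting of functions,
  with pointwise linear structure and multiplication \<open>mul\<close>.
\<close>

definition two_sided_ideal ::
    "(('a \<Rightarrow> 'k::comm_ring_1) \<Rightarrow> ('a \<Rightarrow> 'k) \<Rightarrow> 'a \<Rightarrow> 'k) \<Rightarrow> ('a \<Rightarrow> 'k) set \<Rightarrow> ('a \<Rightarrow> 'k) set \<Rightarrow> bool" where
  "two_sided_ideal mul A I \<longleftrightarrow> I \<subseteq> A \<and> fun_module.subspace I \<and>
     (\<forall>f\<in>A. \<forall>g\<in>I. mul f g \<in> I \<and> mul g f \<in> I)"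

definition simple_algebra ::
    "(('a \<Rightarrow> 'k::comm_ring_1) \<Rightarrow> ('a \<Rightarrow> 'k) \<Rightarrow> 'a \<Rightarrow> 'k) \<Rightarrow> ('a \<Rightarrow> 'k) set \<Rightarrow> bool" where
  "simple_algebra mul A \<longleftrightarrow> A \<noteq> {0} \<and> (\<forall>I. two_sided_ideal mul A I \<longrightarrow> I = {0} \<or> I = A)"

end

theory Submission
  imports Defs
begin

text \<open>
  If the Steinberg algebra is simple, each of the following ideals is zero because it is proper:
  the singular functions (an ideal since every element of the algebra is constant on a
  non-empty open subset of any non-empty open set); the functions vanishing on all arrows
  that start in the orbit of a given unit, which forces the orbit to be dense; and the kernel of the
  action on functions on the unit space, which contains \<open>\<chi>\<^bsub>U\<^esub> - \<chi>\<^bsub>d(U)\<^esub>\<close> whenever \<open>U\<close> is a compact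
  bisection inside the isotropy.

  Conversely, a non-singular element of an ideal is a non-zero constant on some compact bisection, which
  can be translated into the unit space.  Effectiveness yields a smaller compact open set \<open>Z\<close> of
  units such that cutting down by \<open>\<chi>\<^bsub>Z\<^esub>\<close> on both sides leaves a multiple of \<open>\<chi>\<^bsub>Z\<^esub>\<close>.
  Minimality then moves \<open>Z\<close> to a neighbourhood of any unit, and compactness
  gives all \<open>\<chi>\<^bsub>U\<^esub>\<close>.
\<close>

section \<open>Groupoid identities\<close>

text \<open>Since arrows need not be separated by open sets, a compact bisection need not be closed,
  its indicator need not be continuous, and the support of an algebra element need not be open.
  Three substitutes shape the proof: supports are covered by finitely many compact bisections; local
  constancy is weakened to constancy on some open piece of every open set; and closedness is used
  only in the unit space and pulled back along \<open>grng\<close>. The algebra need not have an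
  identity either, so an ideal is shown to be everything by producing local units for each
  generator. The element built from an isotropy bisection U works because a and d(a) then have the
  same source and the same target: functions on the unit space cannot tell them apart, while the
  algebra can. In the converse no unit with trivial isotropy is chosen. Finitely many bisections
  cover the element, and each is dealt with in turn: either the two ends of one of its arrows are
  separated, or effectiveness makes it lie in the units over the set considered.\<close>

context groupoid
begin

lemma units_arrows: "u \<in> units G \<Longrightarrow> u \<in> arrows G"
  by (auto simp: units_def dom_closed)

lemma dom_unit: "u \<in> units G \<Longrightarrow> gdom G u = u"
  by (auto simp: units_def dom_dom)

lemma rng_unit: "u \<in> units G \<Longrightarrow> grng G u = u"
  by (auto simp: units_def rng_dom)

lemma dom_in_units: "a \<in> arrows G \<Longrightarrow> gdom G a \<in> units G"
  by (auto simp: units_def)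

lemma rng_in_units: "a \<in> arrows G \<Longrightarrow> grng G a \<in> units G"
  by (metis dom_in_units dom_rng rng_closed)

lemma mult_arrows:
  "a \<in> arrows G \<Longrightarrow> b \<in> arrows G \<Longrightarrow> gdom G a = grng G b \<Longrightarrow> gmult G a b \<in> arrows G"
  by (simp add: composable_def mult_closed)

lemma dom_mult':
  "a \<in> arrows G \<Longrightarrow> b \<in> arrows G \<Longrightarrow> gdom G a = grng G b \<Longrightarrow> gdom G (gmult G a b) = gdom G b"
  by (simp add: composable_def dom_mult)

lemma rng_mult':
  "a \<in> arrows G \<Longrightarrow> b \<in> arrows G \<Longrightarrow> gdom G a = grng G b \<Longrightarrow> grng G (gmult G a b) = grng G a"
  by (simp add: composable_def rng_mult)

lemma mult_assoc':
  "a \<in> arrows G \<Longrightarrow> b \<in> arrows G \<Longrightarrow> c \<in> arrows G \<Longrightarrow> gdom G a = grng G b \<Longrightarrow> gdom G b = grng G c \<Longrightarrow>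
   gmult G (gmult G a b) c = gmult G a (gmult G b c)"
  by (simp add: composable_def mult_assoc)

lemma inv_mult_cancel:
  assumes "a \<in> arrows G" "b \<in> arrows G" "gdom G a = grng G b"
  shows "gmult G (ginv G a) (gmult G a b) = b"
  using assms mult_assoc'[of "ginv G a" a b]
  by (simp add: inv_closed dom_inv inv_mult rng_mult_left)

lemma mult_inv_cancel:
  assumes "a \<in> arrows G" "c \<in> arrows G" "grng G a = grng G c"
  shows "gmult G a (gmult G (ginv G a) c) = c"
  using assms mult_assoc'[of a "ginv G a" c]
  by (simp add: inv_closed dom_inv rng_inv mult_inv rng_mult_left)

lemma left_cancel:
  assumes "a \<in> arrows G" "b \<in> arrows G" "c \<in> arrows G"
    and "gdom G a = grng G b" "gdom G a = grng G c" "gmult G a b = gmult G a c"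
  shows "b = c"
  using assms inv_mult_cancel by metis

lemma inv_inv:
  assumes "a \<in> arrows G"
  shows "ginv G (ginv G a) = a"
  using assms mult_inv_cancel[of "ginv G a" "gdom G a"] mult_dom[of "ginv G (ginv G a)"]
    left_cancel[of "ginv G a" "ginv G (ginv G a)" a]
  by (simp add: inv_closed dom_inv rng_inv inv_mult mult_inv)

lemma inv_mult_distrib:
  assumes "a \<in> arrows G" "b \<in> arrows G" "gdom G a = grng G b"
  shows "ginv G (gmult G a b) = gmult G (ginv G b) (ginv G a)"
proof -
  have c: "gmult G a b \<in> arrows G" and i: "gmult G (ginv G b) (ginv G a) \<in> arrows G"
    using assms by (simp_all add: mult_arrows inv_closed dom_inv rng_inv)
  \<comment> \<open>The candidate is a right inverse of the product; left cancellation then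
    identifies it with the inverse.\<close>
  have "gmult G (gmult G a b) (gmult G (ginv G b) (ginv G a))
    = gmult G a (gmult G b (gmult G (ginv G b) (ginv G a)))"
    using assms i by (simp add: mult_assoc' inv_closed dom_inv rng_inv rng_mult')
  also have "\<dots> = grng G (gmult G a b)"
    using assms by (simp add: mult_inv_cancel inv_closed dom_inv rng_inv rng_mult' mult_inv)
  finally show ?thesis
    using assms c i left_cancel[of "gmult G a b" "ginv G (gmult G a b)" "gmult G (ginv G b) (ginv G a)"]
    by (simp add: mult_inv rng_inv dom_mult' rng_mult' inv_closed dom_inv)
qed

lemma inv_unit: "u \<in> units G \<Longrightarrow> ginv G u = u"
  by (metis dom_inv dom_unit inv_closed inv_mult mult_dom rng_unit units_arrows)

text \<open>On bisections this is the product of the inverse semigroup of local bisections, which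
  convolution of indicators reproduces.\<close>

definition setmult :: "'a set \<Rightarrow> 'a set \<Rightarrow> 'a set" where
  "setmult U V = {gmult G a b | a b. a \<in> U \<and> b \<in> V \<and> gdom G a = grng G b}"

lemma setmultI: "a \<in> U \<Longrightarrow> b \<in> V \<Longrightarrow> gdom G a = grng G b \<Longrightarrow> gmult G a b \<in> setmult U V"
  by (auto simp: setmult_def)

end

section \<open>Compact local bisections\<close>

lemma homeomorphic_map_restrict_open:
  assumes "continuous_map X Y f" "open_map X Y f" "openin X U" "inj_on f U"
  shows "homeomorphic_map (subtopology X U) (subtopology Y (f ` U)) f"
proof (rule bijective_open_imp_homeomorphic_map)
  have U: "U \<subseteq> topspace X" using assms(3) openin_subset by blast
  show "continuous_map (subtopology X U) (subtopology Y (f ` U)) f"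
    using assms(1) U by (auto simp: continuous_map_in_subtopology continuous_map_from_subtopology)
  show "open_map (subtopology X U) (subtopology Y (f ` U)) f"
    unfolding open_map_def
  proof (intro allI impI)
    fix V assume "openin (subtopology X U) V"
    then have V: "openin X V" "V \<subseteq> U"
      using assms(3) by (simp_all add: openin_open_subtopology)
    then have "openin Y (f ` V)" using assms(2) by (simp add: open_map_def)
    moreover have "f ` V = f ` V \<inter> f ` U" using V(2) by blast
    ultimately show "openin (subtopology Y (f ` U)) (f ` V)"
      unfolding openin_subtopology by blast
  qed
  show "f ` topspace (subtopology X U) = topspace (subtopology Y (f ` U))"
    using U assms(1) by (auto simp: continuous_map_def)
  show "inj_on f (topspace (subtopology X U))"
    using U assms(4) by (simp add: inj_on_subset)
qed

section \<open>Openness of the units and of the structure maps; bisections and translations\<close>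

context etale_groupoid
begin

lemma topspace_unit_space: "topspace (unit_space G) = units G"
  by (auto simp: unit_space_def arrows_def[symmetric] units_arrows)

lemma openin_arrows: "openin (gtop G) U \<Longrightarrow> U \<subseteq> arrows G"
  by (simp add: arrows_def openin_subset)

lemma open_map_dom: "open_map (gtop G) (unit_space G) (gdom G)"
  unfolding open_map_def
proof (intro allI impI)
  fix W assume W: "openin (gtop G) W"
  show "openin (unit_space G) (gdom G ` W)"
  proof (subst openin_subopen, intro ballI)
    fix y assume "y \<in> gdom G ` W"
    then obtain x where x: "x \<in> W" "y = gdom G x" by auto
    then have "x \<in> topspace (gtop G)" using W openin_subset by blast
    then obtain U where U: "openin (gtop G) U" "x \<in> U" "openin (unit_space G) (gdom G ` U)"
      "homeomorphic_map (subtopology (gtop G) U) (subtopology (unit_space G) (gdom G ` U)) (gdom G)"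
      using local_homeomorphism_dom unfolding local_homeomorphism_map_def by blast
    have "openin (subtopology (gtop G) U) (U \<inter> W)"
      using W openin_subtopology_Int2 by blast
    then have "openin (subtopology (unit_space G) (gdom G ` U)) (gdom G ` (U \<inter> W))"
      using U(4) homeomorphic_imp_open_map open_map_def by blast
    then have "openin (unit_space G) (gdom G ` (U \<inter> W))"
      using U(3) openin_trans_full by blast
    then show "\<exists>T. openin (unit_space G) T \<and> y \<in> T \<and> T \<subseteq> gdom G ` W"
      using x U(2) by blast
  qed
qed

text \<open>Near a unit x take an open U on which d is injective. If g and d(g) both lie in U, then
  d(d(g)) = d(g) forces g = d(g). The set of such g is open by continuity of d and contains
  x.\<close>

lemma open_units: "openin (gtop G) (units G)"
proof (subst openin_subopen, intro ballI)
  fix x assume x: "x \<in> units G"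
  then have "x \<in> topspace (gtop G)" using units_arrows arrows_def by fastforce
  then obtain U where U: "openin (gtop G) U" "x \<in> U"
    "homeomorphic_map (subtopology (gtop G) U) (subtopology (unit_space G) (gdom G ` U)) (gdom G)"
    using local_homeomorphism_dom unfolding local_homeomorphism_map_def by blast
  have inj: "inj_on (gdom G) U"
    using U(3) homeomorphic_imp_injective_map openin_subset[OF U(1)] by (fastforce simp: Int_absorb1)
  have "openin (unit_space G) (U \<inter> units G)"
    unfolding unit_space_def using U(1) by (auto simp: openin_subtopology)
  then have "openin (gtop G) {g \<in> topspace (gtop G). gdom G g \<in> U \<inter> units G}"
    using continuous_dom openin_continuous_map_preimage by blast
  then have "openin (gtop G) (U \<inter> {g \<in> topspace (gtop G). gdom G g \<in> U \<inter> units G})"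
    using U(1) by blast
  moreover have "U \<inter> {g \<in> topspace (gtop G). gdom G g \<in> U \<inter> units G} \<subseteq> units G"
  proof
    fix g assume g: "g \<in> U \<inter> {g \<in> topspace (gtop G). gdom G g \<in> U \<inter> units G}"
    then have "gdom G (gdom G g) = gdom G g" by (simp add: arrows_def[symmetric] dom_dom)
    with inj g have "gdom G g = g" by (auto dest: inj_onD)
    with g show "g \<in> units G" by auto
  qed
  ultimately show "\<exists>T. openin (gtop G) T \<and> x \<in> T \<and> T \<subseteq> units G"
    using x U(2) \<open>x \<in> topspace (gtop G)\<close> dom_unit by (metis (no_types, lifting) IntI mem_Collect_eq)
qed

lemma openin_unit_space: "openin (unit_space G) U \<longleftrightarrow> openin (gtop G) U \<and> U \<subseteq> units G"
  by (simp add: unit_space_def open_units openin_open_subtopology)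

lemma compactin_unit_space: "compactin (unit_space G) U \<longleftrightarrow> compactin (gtop G) U \<and> U \<subseteq> units G"
  by (auto simp: unit_space_def compactin_subtopology)

text \<open>Inversion is an involution, so the image of U is also its preimage.\<close>

lemma open_image_inv:
  assumes "openin (gtop G) U"
  shows "openin (gtop G) (ginv G ` U)"
proof -
  have "ginv G ` U = {a \<in> topspace (gtop G). ginv G a \<in> U}"
  proof (intro set_eqI iffI)
    fix a assume "a \<in> {a \<in> topspace (gtop G). ginv G a \<in> U}"
    then show "a \<in> ginv G ` U"
      using inv_inv[of a] by (metis (no_types, lifting) arrows_def imageI mem_Collect_eq)
  qed (use openin_arrows[OF assms] in \<open>auto simp: arrows_def[symmetric] inv_closed inv_inv subset_iff\<close>)
  then show ?thesis
    using openin_continuous_map_preimage[OF continuous_inv assms] by simp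
qed

lemma open_map_rng: "open_map (gtop G) (unit_space G) (grng G)"
  unfolding open_map_def
proof (intro allI impI)
  fix W assume W: "openin (gtop G) W"
  have "grng G ` W = gdom G ` ginv G ` W"
    using openin_arrows[OF W] by (auto simp: image_image dom_inv subset_iff intro!: image_cong)
  then show "openin (unit_space G) (grng G ` W)"
    using open_image_inv[OF W] open_map_dom unfolding open_map_def by simp
qed

text \<open>As \<open>gdom\<close> and \<open>grng\<close> are continuous and open, injectivity is
  all that remains of the two homeomorphism conditions. Later verifications use this form.\<close>

lemma local_bisection_iff:
  "local_bisection G U \<longleftrightarrow> openin (gtop G) U \<and> inj_on (gdom G) U \<and> inj_on (grng G) U"
proof
  assume L: "local_bisection G U"
  then have "U \<subseteq> topspace (gtop G)"
    unfolding local_bisection_def using openin_subset by blast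
  with L show "openin (gtop G) U \<and> inj_on (gdom G) U \<and> inj_on (grng G) U"
    unfolding local_bisection_def
    by (metis homeomorphic_imp_injective_map topspace_subtopology_subset)
next
  assume "openin (gtop G) U \<and> inj_on (gdom G) U \<and> inj_on (grng G) U"
  then show "local_bisection G U"
    unfolding local_bisection_def
    using homeomorphic_map_restrict_open continuous_dom continuous_rng open_map_dom open_map_rng by blast
qed

lemma local_bisection_subset:
  "local_bisection G U \<Longrightarrow> openin (gtop G) V \<Longrightarrow> V \<subseteq> U \<Longrightarrow> local_bisection G V"
  by (auto simp: local_bisection_iff intro: inj_on_subset)

lemma local_bisection_arrows: "local_bisection G U \<Longrightarrow> U \<subseteq> arrows G"
  by (simp add: local_bisection_iff openin_arrows)

lemma local_bisection_domD:
  "local_bisection G U \<Longrightarrow> a \<in> U \<Longrightarrow> b \<in> U \<Longrightarrow> gdom G a = gdom G b \<Longrightarrow> a = b"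
  by (auto simp: local_bisection_iff dest: inj_onD)

lemma local_bisection_rngD:
  "local_bisection G U \<Longrightarrow> a \<in> U \<Longrightarrow> b \<in> U \<Longrightarrow> grng G a = grng G b \<Longrightarrow> a = b"
  by (auto simp: local_bisection_iff dest: inj_onD)

lemma local_bisection_inv:
  assumes "local_bisection G U"
  shows "local_bisection G (ginv G ` U)"
  using assms local_bisection_arrows[OF assms] unfolding local_bisection_iff
  by (auto simp: open_image_inv inj_on_def dom_inv rng_inv subset_iff)

text \<open>With s the inverse of d on U, the map sends b to the product of s(r(b)) and b. Having
  multiplication by a whole bisection as one continuous map yields both openness and compactness of
  products.\<close>

lemma left_translation:
  assumes U: "local_bisection G U"
  obtains t where
    "continuous_map (subtopology (gtop G) {b \<in> arrows G. grng G b \<in> gdom G ` U}) (gtop G) t"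
    "\<And>a b. a \<in> U \<Longrightarrow> b \<in> arrows G \<Longrightarrow> gdom G a = grng G b \<Longrightarrow> t b = gmult G a b"
proof -
  let ?B = "{b \<in> arrows G. grng G b \<in> gdom G ` U}"
  have Ua: "U \<subseteq> arrows G" using U by (rule local_bisection_arrows)
  have "homeomorphic_map (subtopology (gtop G) U) (subtopology (unit_space G) (gdom G ` U)) (gdom G)"
    using U by (simp add: local_bisection_def)
  then obtain s where s: "homeomorphic_maps (subtopology (gtop G) U) (subtopology (unit_space G) (gdom G ` U)) (gdom G) s"
    using homeomorphic_map_maps by blast
  then have cs: "continuous_map (subtopology (unit_space G) (gdom G ` U)) (gtop G) s"
    by (auto simp: homeomorphic_maps_def continuous_map_in_subtopology)
  have sd: "s (gdom G a) = a" if "a \<in> U" for a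
    using s that Ua by (auto simp: homeomorphic_maps_def arrows_def)
  have "continuous_map (subtopology (gtop G) ?B) (subtopology (unit_space G) (gdom G ` U)) (grng G)"
    using continuous_rng by (auto simp: continuous_map_in_subtopology continuous_map_from_subtopology)
  then have "continuous_map (subtopology (gtop G) ?B) (gtop G) (\<lambda>b. s (grng G b))"
    using continuous_map_compose[OF _ cs] by (simp add: o_def)
  then have "continuous_map (subtopology (gtop G) ?B) (prod_topology (gtop G) (gtop G)) (\<lambda>b. (s (grng G b), b))"
    by (simp add: continuous_map_paired continuous_map_from_subtopology)
  then have "continuous_map (subtopology (gtop G) ?B)
      (subtopology (prod_topology (gtop G) (gtop G)) (composable G)) (\<lambda>b. (s (grng G b), b))"
    using sd Ua by (auto simp: continuous_map_in_subtopology composable_def)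
  then have "continuous_map (subtopology (gtop G) ?B) (gtop G) (\<lambda>b. gmult G (s (grng G b)) b)"
    using continuous_map_compose[OF _ continuous_mult] by (fastforce simp: o_def)
  then show thesis
    by (rule that) (metis sd)
qed

lemma open_rng_preimage:
  assumes "openin (gtop G) U"
  shows "openin (gtop G) {b \<in> arrows G. grng G b \<in> gdom G ` U}"
proof -
  have "openin (unit_space G) (gdom G ` U)" using assms open_map_dom open_map_def by blast
  then show ?thesis using continuous_rng unfolding arrows_def
    using openin_continuous_map_preimage by blast
qed

text \<open>The product of U and W is the preimage of W under left translation by U^-1, whose domain
  is open.\<close>

lemma open_setmult:
  assumes U: "local_bisection G U" and W: "openin (gtop G) W"
  shows "openin (gtop G) (setmult U W)"
proof -
  let ?I = "ginv G ` U"
  let ?B = "{b \<in> arrows G. grng G b \<in> gdom G ` ?I}"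
  have Ua: "U \<subseteq> arrows G" and Wa: "W \<subseteq> arrows G"
    using U W by (simp_all add: local_bisection_arrows openin_arrows)
  have I: "local_bisection G ?I" using U by (rule local_bisection_inv)
  obtain t where t: "continuous_map (subtopology (gtop G) ?B) (gtop G) t"
    "\<And>a b. a \<in> ?I \<Longrightarrow> b \<in> arrows G \<Longrightarrow> gdom G a = grng G b \<Longrightarrow> t b = gmult G a b"
    using left_translation[OF I] by metis
  have B: "openin (gtop G) ?B"
    using I open_rng_preimage local_bisection_iff by blast
  have "openin (subtopology (gtop G) ?B) {b \<in> topspace (subtopology (gtop G) ?B). t b \<in> W}"
    using t(1) W by (rule openin_continuous_map_preimage)
  then have "openin (gtop G) {b \<in> ?B. t b \<in> W}"
    using B openin_trans_full by (auto simp: arrows_def cong: conj_cong)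
  moreover have "{b \<in> ?B. t b \<in> W} = setmult U W"
  proof (intro set_eqI iffI)
    fix c assume "c \<in> {b \<in> ?B. t b \<in> W}"
    then obtain a where a: "a \<in> U" "c \<in> arrows G" "grng G c = grng G a" "t c \<in> W"
      using Ua by (auto simp: dom_inv subset_iff)
    then have "t c = gmult G (ginv G a) c" using Ua t(2)[of "ginv G a" c] by (auto simp: dom_inv)
    then have "c = gmult G a (t c)" "gdom G a = grng G (t c)"
      using a Ua by (auto simp: mult_inv_cancel rng_mult' inv_closed dom_inv rng_inv subset_iff)
    then show "c \<in> setmult U W" using a setmultI by metis
  next
    fix c assume "c \<in> setmult U W"
    then obtain a b where ab: "a \<in> U" "b \<in> W" "gdom G a = grng G b" "c = gmult G a b"
      by (auto simp: setmult_def)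
    then have ar: "a \<in> arrows G" "b \<in> arrows G" using Ua Wa by auto
    then have c: "c \<in> arrows G" "grng G c = gdom G (ginv G a)"
      using ab by (simp_all add: mult_arrows rng_mult' dom_inv)
    then have "t c = b"
      using t(2)[of "ginv G a" c] ab ar by (simp add: inv_mult_cancel)
    then show "c \<in> {b \<in> ?B. t b \<in> W}" using c ab by auto
  qed
  ultimately show ?thesis by simp
qed

section \<open>Compact bisections and their products\<close>

definition compact_bisection :: "'a set \<Rightarrow> bool" where
  "compact_bisection U \<longleftrightarrow> local_bisection G U \<and> compactin (gtop G) U"

lemma compact_bisection_local: "compact_bisection U \<Longrightarrow> local_bisection G U"
  by (simp add: compact_bisection_def)

lemma compact_bisection_inv:
  assumes "compact_bisection U"
  shows "compact_bisection (ginv G ` U)"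
  using assms continuous_inv image_compactin local_bisection_inv unfolding compact_bisection_def by blast

lemma compact_bisection_units:
  "compact_bisection U \<and> U \<subseteq> units G \<longleftrightarrow> openin (unit_space G) U \<and> compactin (unit_space G) U"
  by (auto simp: compact_bisection_def local_bisection_iff openin_unit_space compactin_unit_space
      inj_on_def dom_unit rng_unit subset_iff)

lemma compact_bisection_dom:
  assumes "compact_bisection U"
  shows "compact_bisection (gdom G ` U)" "gdom G ` U \<subseteq> units G"
proof -
  have "openin (unit_space G) (gdom G ` U) \<and> compactin (unit_space G) (gdom G ` U)"
    using assms open_map_dom continuous_dom image_compactin
    unfolding compact_bisection_def local_bisection_iff open_map_def by blast
  then show "compact_bisection (gdom G ` U)" "gdom G ` U \<subseteq> units G"
    unfolding compact_bisection_units[symmetric] by simp_all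
qed

lemma compact_bisection_setmult:
  assumes U: "compact_bisection U" and V: "compact_bisection V"
  shows "compact_bisection (setmult U V)"
proof -
  have Ul: "local_bisection G U" and Vl: "local_bisection G V"
    using U V by (simp_all add: compact_bisection_local)
  have Ua: "U \<subseteq> arrows G" and Va: "V \<subseteq> arrows G"
    using Ul Vl by (simp_all add: local_bisection_arrows)
  have "openin (gtop G) (setmult U V)"
    using Ul Vl open_setmult local_bisection_iff by blast
  moreover have "inj_on (gdom G) (setmult U V)"
  proof (rule inj_onI)
    fix c c' assume "c \<in> setmult U V" "c' \<in> setmult U V" and e: "gdom G c = gdom G c'"
    then obtain a b a' b' where ab: "a \<in> U" "b \<in> V" "gdom G a = grng G b" "c = gmult G a b"
      and ab': "a' \<in> U" "b' \<in> V" "gdom G a' = grng G b'" "c' = gmult G a' b'"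
      by (auto simp: setmult_def)
    then have "gdom G b = gdom G b'" using e Ua Va by (auto simp: dom_mult' subset_iff)
    then have "b = b'" using ab ab' Vl local_bisection_domD by blast
    moreover from this have "a = a'" using ab ab' Ul local_bisection_domD by metis
    ultimately show "c = c'" using ab ab' by simp
  qed
  moreover have "inj_on (grng G) (setmult U V)"
  proof (rule inj_onI)
    fix c c' assume "c \<in> setmult U V" "c' \<in> setmult U V" and e: "grng G c = grng G c'"
    then obtain a b a' b' where ab: "a \<in> U" "b \<in> V" "gdom G a = grng G b" "c = gmult G a b"
      and ab': "a' \<in> U" "b' \<in> V" "gdom G a' = grng G b'" "c' = gmult G a' b'"
      by (auto simp: setmult_def)
    then have "grng G a = grng G a'" using e Ua Va by (auto simp: rng_mult' subset_iff)
    then have "a = a'" using ab ab' Ul local_bisection_rngD by blast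
    moreover from this have "b = b'" using ab ab' Vl local_bisection_rngD by metis
    ultimately show "c = c'" using ab ab' by simp
  qed
  moreover have "compactin (gtop G) (setmult U V)"
  proof -
    let ?B = "{b \<in> arrows G. grng G b \<in> gdom G ` U}"
    obtain t where t: "continuous_map (subtopology (gtop G) ?B) (gtop G) t"
      "\<And>a b. a \<in> U \<Longrightarrow> b \<in> arrows G \<Longrightarrow> gdom G a = grng G b \<Longrightarrow> t b = gmult G a b"
      using left_translation[OF Ul] by metis
    have "compactin (unit_space G) (gdom G ` U)"
      using compact_bisection_dom[OF U] compact_bisection_units by blast
    \<comment> \<open>The Hausdorff property of the unit space enters here: the arrows composable
      with U on its right form a closed set, so those lying in V are compact even if the arrow space
      is not Hausdorff.\<close>
    then have "closedin (unit_space G) (gdom G ` U)"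
      using Hausdorff_units compactin_imp_closedin by blast
    then have "closedin (gtop G) ?B"
      using closedin_continuous_map_preimage[OF continuous_rng] by (simp add: arrows_def)
    then have "compactin (gtop G) (?B \<inter> V)"
      using V closed_Int_compactin compact_bisection_def by blast
    then have "compactin (subtopology (gtop G) ?B) (?B \<inter> V)"
      by (simp add: compactin_subtopology)
    then have "compactin (gtop G) (t ` (?B \<inter> V))"
      using t(1) image_compactin by blast
    moreover have "t ` (?B \<inter> V) = setmult U V"
    proof (intro set_eqI iffI)
      fix c assume "c \<in> t ` (?B \<inter> V)"
      then obtain a b where ab: "a \<in> U" "b \<in> V" "b \<in> arrows G" "gdom G a = grng G b" "c = t b"
        by auto
      then show "c \<in> setmult U V" using t(2)[of a b] by (simp add: setmultI)
    next
      fix c assume "c \<in> setmult U V"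
      then obtain a b where ab: "a \<in> U" "b \<in> V" "gdom G a = grng G b" "c = gmult G a b"
        by (auto simp: setmult_def)
      then have "b \<in> ?B \<inter> V" "c = t b" using Va t(2)[of a b] by (auto intro: rev_image_eqI)
      then show "c \<in> t ` (?B \<inter> V)" by blast
    qed
    ultimately show ?thesis by simp
  qed
  ultimately show ?thesis by (simp add: compact_bisection_def local_bisection_iff)
qed

end

section \<open>Compact bisections form a neighbourhood base\<close>

context ample_groupoid
begin

lemma compact_open_nbhd_unit:
  assumes "openin (unit_space G) W" "x \<in> W"
  obtains Z where "compact_bisection Z" "x \<in> Z" "Z \<subseteq> W" "Z \<subseteq> units G"
proof -
  obtain \<B> where B: "\<forall>B\<in>\<B>. openin (unit_space G) B \<and> compactin (unit_space G) B"
    "openin (unit_space G) = arbitrary union_of (\<lambda>B. B \<in> \<B>)"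
    using compact_open_base by blast
  then have "(arbitrary union_of (\<lambda>B. B \<in> \<B>)) W" using assms(1) by simp
  then obtain Z where "Z \<in> \<B>" "x \<in> Z" "Z \<subseteq> W"
    using assms(2) by (auto simp: union_of_def)
  then show thesis using that B compact_bisection_units by metis
qed

lemma compact_bisection_nbhd:
  assumes W: "openin (gtop G) W" "g \<in> W"
  obtains U where "compact_bisection U" "g \<in> U" "U \<subseteq> W"
proof -
  have loc: "\<exists>U. openin (gtop G) U \<and> h \<in> U \<and> inj_on (gdom G) U" if "h \<in> arrows G" for h
  proof -
    obtain U where U: "openin (gtop G) U" "h \<in> U"
      "homeomorphic_map (subtopology (gtop G) U) (subtopology (unit_space G) (gdom G ` U)) (gdom G)"
      using local_homeomorphism_dom \<open>h \<in> arrows G\<close> unfolding local_homeomorphism_map_def arrows_def by blast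
    then have "inj_on (gdom G) U"
      using homeomorphic_imp_injective_map openin_subset[OF U(1)] by (fastforce simp: Int_absorb1)
    with U show ?thesis by blast
  qed
  have g: "g \<in> arrows G" using W openin_arrows by blast
  obtain U1 where U1: "openin (gtop G) U1" "g \<in> U1" "inj_on (gdom G) U1" using loc[OF g] by blast
  \<comment> \<open>Injectivity of d near g^-1 becomes injectivity of r near g after
    inversion.\<close>
  obtain U2 where U2: "openin (gtop G) U2" "ginv G g \<in> U2" "inj_on (gdom G) U2"
    using loc[OF inv_closed[OF g]] by blast
  let ?O = "U1 \<inter> ginv G ` U2 \<inter> W"
  have O: "openin (gtop G) ?O" using U1(1) open_image_inv[OF U2(1)] W(1) by blast
  have gO: "g \<in> ?O" using U1 U2 W g inv_inv by (auto simp: image_iff) (metis)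
  have "inj_on (gdom G) ?O" using U1(3) by (auto intro: inj_on_subset)
  moreover have "inj_on (grng G) (ginv G ` U2)"
    using U2 openin_arrows[OF U2(1)] by (auto simp: inj_on_def rng_inv subset_iff)
  then have "inj_on (grng G) ?O" by (rule inj_on_subset) auto
  ultimately have L: "local_bisection G ?O" using O by (simp add: local_bisection_iff)
  have "openin (unit_space G) (gdom G ` ?O)" using O open_map_dom open_map_def by blast
  then obtain Z where Z: "compact_bisection Z" "gdom G g \<in> Z" "Z \<subseteq> gdom G ` ?O" "Z \<subseteq> units G"
    using compact_open_nbhd_unit gO by (metis image_eqI)
  obtain s where s: "homeomorphic_maps (subtopology (gtop G) ?O) (subtopology (unit_space G) (gdom G ` ?O)) (gdom G) s"
    using L homeomorphic_map_maps local_bisection_def by blast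
  then have cs: "continuous_map (subtopology (unit_space G) (gdom G ` ?O)) (gtop G) s"
    by (auto simp: homeomorphic_maps_def continuous_map_in_subtopology)
  have sd: "s (gdom G a) = a" if "a \<in> ?O" for a
    using s that O openin_subset by (fastforce simp: homeomorphic_maps_def)
  \<comment> \<open>The part of the bisection lying over the compact open set Z is the image of Z
    under the local section s; this is why it is compact.\<close>
  let ?V = "?O \<inter> {a \<in> arrows G. gdom G a \<in> Z}"
  have "openin (unit_space G) Z" "compactin (unit_space G) Z" using Z compact_bisection_units by blast+
  then have "openin (gtop G) {a \<in> arrows G. gdom G a \<in> Z}"
    using continuous_dom unfolding arrows_def using openin_continuous_map_preimage by blast
  then have V: "local_bisection G ?V" using local_bisection_subset[OF L] O by blast
  have "compactin (subtopology (unit_space G) (gdom G ` ?O)) Z"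
    using Z \<open>compactin (unit_space G) Z\<close> by (simp add: compactin_subtopology)
  then have "compactin (gtop G) (s ` Z)" using cs image_compactin by blast
  moreover have "s ` Z = ?V"
  proof (intro set_eqI iffI)
    fix a assume "a \<in> s ` Z"
    then obtain z where "z \<in> Z" "a = s z" by blast
    moreover from this obtain b where "b \<in> ?O" "z = gdom G b" using Z(3) by blast
    ultimately show "a \<in> ?V" using sd[of b] openin_arrows[OF O] by auto
  next
    fix a assume "a \<in> ?V"
    then show "a \<in> s ` Z" using sd[of a] by (metis (no_types, lifting) IntE image_eqI mem_Collect_eq)
  qed
  ultimately have "compact_bisection ?V" using V by (simp add: compact_bisection_def)
  then show thesis using that[of ?V] gO Z(2) g by blast
qed

end

section \<open>The convolution algebra\<close>

context etale_groupoid
begin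

lemma steinberg_subspace: "fun_module.subspace (steinberg_algebra G)"
  by (simp add: steinberg_algebra_def fun_module.subspace_span)

lemma steinberg_indicator: "compact_bisection U \<Longrightarrow> indicator U \<in> steinberg_algebra G"
  unfolding steinberg_algebra_def compact_bisection_def by (auto intro: fun_module.span_base)

text \<open>The subspace fed to minimality of the span consists of the members satisfying P, so the
  cases for sums and multiples may also assume membership of the functions involved.\<close>

lemma steinberg_induct [consumes 1, case_names zero indicator add scale]:
  fixes f :: "'a \<Rightarrow> 'k::comm_ring_1"
  assumes f: "f \<in> steinberg_algebra G"
    and "P 0"
    and "\<And>U. compact_bisection U \<Longrightarrow> P (indicator U)"
    and "\<And>f g. f \<in> steinberg_algebra G \<Longrightarrow> g \<in> steinberg_algebra G \<Longrightarrow> P f \<Longrightarrow> P g \<Longrightarrow> P (f + g)"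
    and "\<And>c f. f \<in> steinberg_algebra G \<Longrightarrow> P f \<Longrightarrow> P (fun_scale c f)"
  shows "P f"
proof -
  let ?T = "{f \<in> steinberg_algebra G. P f}"
  have "fun_module.subspace ?T"
    using assms steinberg_subspace unfolding fun_module.subspace_def by auto
  moreover have "{indicator U | U. local_bisection G U \<and> compactin (gtop G) U} \<subseteq> ?T"
    using assms(3) steinberg_indicator by (auto simp: compact_bisection_def[symmetric])
  ultimately have "steinberg_algebra G \<subseteq> ?T"
    unfolding steinberg_algebra_def using fun_module.span_minimal by blast
  with f show ?thesis by blast
qed

text \<open>A cover rather than the support itself is recorded, because supports may fail to be
  open. It gives finiteness on fibres and, later, the finite list of bisections to which
  effectiveness is applied.\<close>

lemma steinberg_support:
  assumes "f \<in> steinberg_algebra G"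
  shows "\<exists>F. finite F \<and> (\<forall>U\<in>F. compact_bisection U) \<and> {g. f g \<noteq> 0} \<subseteq> \<Union>F"
  using assms
proof (induction rule: steinberg_induct)
  case zero
  then show ?case by (auto intro: exI[of _ "{}"])
next
  case (indicator U)
  then show ?case by (intro exI[of _ "{U}"]) (auto simp: indicator_def)
next
  case (add f g)
  then obtain F F' where "finite F" "\<forall>U\<in>F. compact_bisection U" "{x. f x \<noteq> 0} \<subseteq> \<Union>F"
    "finite F'" "\<forall>U\<in>F'. compact_bisection U" "{x. g x \<noteq> 0} \<subseteq> \<Union>F'"
    by blast
  moreover from this have "{x. (f + g) x \<noteq> 0} \<subseteq> \<Union>(F \<union> F')"
    by (auto simp: subset_iff) (metis add_0)
  ultimately show ?case by (intro exI[of _ "F \<union> F'"]) blast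
next
  case (scale c f)
  then obtain F where "finite F" "\<forall>U\<in>F. compact_bisection U" "{x. f x \<noteq> 0} \<subseteq> \<Union>F"
    by blast
  then show ?case by (intro exI[of _ F]) (auto simp: fun_scale_def)
qed

lemma steinberg_outside:
  assumes "f \<in> steinberg_algebra G" "g \<notin> arrows G"
  shows "f g = 0"
  using steinberg_support[OF assms(1)] assms(2) compact_bisection_local local_bisection_arrows by blast

text \<open>Each bisection of a finite cover of the support meets a fibre of p at most once. The map
  p will be \<open>gdom\<close> or \<open>grng\<close>.\<close>

lemma finite_support_fibre:
  assumes f: "f \<in> steinberg_algebra G"
    and inj: "\<And>U. compact_bisection U \<Longrightarrow> inj_on p U"
  shows "finite {a. p a = y \<and> f a \<noteq> 0}"
proof -
  obtain F where F: "finite F" "\<forall>U\<in>F. compact_bisection U" "{x. f x \<noteq> 0} \<subseteq> \<Union>F"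
    using steinberg_support[OF f] by blast
  have "finite {a \<in> U. p a = y}" if "U \<in> F" for U
  proof -
    have "inj_on p {a \<in> U. p a = y}" using F(2) inj that by (auto intro: inj_on_subset)
    then show ?thesis by (rule inj_on_finite[of _ _ "{y}"]) auto
  qed
  then have "finite (\<Union>U\<in>F. {a \<in> U. p a = y})" using F(1) by blast
  then show ?thesis by (rule rev_finite_subset) (use F(3) in blast)
qed

lemma finite_support_dom:
  "f \<in> steinberg_algebra G \<Longrightarrow> finite {a. gdom G a = y \<and> f a \<noteq> 0}"
  by (rule finite_support_fibre) (auto simp: compact_bisection_def local_bisection_iff)

lemma finite_support_rng:
  "f \<in> steinberg_algebra G \<Longrightarrow> finite {a. grng G a = y \<and> f a \<noteq> 0}"
  by (rule finite_support_fibre) (auto simp: compact_bisection_def local_bisection_iff)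

section \<open>Convolution: bilinearity, products of indicators, closure\<close>

lemma convolution_outside: "c \<notin> arrows G \<Longrightarrow> convolution G f h c = 0"
  unfolding convolution_def
  by (rule sum.neutral) (use mult_closed in auto)

text \<open>A factorization of c is determined by its first factor a, the second being a^-1 c. The
  index set in the definition varies with both functions; here any finite F containing the relevant
  support of f serves, so different sums can be compared over one set.\<close>

lemma convolution_sum:
  assumes c: "c \<in> arrows G" and F: "finite F" "F \<subseteq> {a \<in> arrows G. grng G a = grng G c}"
    and supp: "{a \<in> arrows G. grng G a = grng G c \<and> f a \<noteq> 0} \<subseteq> F"
  shows "convolution G f h c = (\<Sum>a\<in>F. f a * h (gmult G (ginv G a) c))"
proof -
  let ?S = "{(a, b) \<in> composable G. gmult G a b = c \<and> f a * h b \<noteq> 0}"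
  let ?F = "{a \<in> F. f a * h (gmult G (ginv G a) c) \<noteq> 0}"
  let ?p = "\<lambda>a. (a, gmult G (ginv G a) c)"
  have "?S = ?p ` ?F"
  proof (intro set_eqI iffI)
    fix z assume "z \<in> ?S"
    then obtain a b where z: "z = (a, b)" "a \<in> arrows G" "b \<in> arrows G" "gdom G a = grng G b"
      "gmult G a b = c" "f a * h b \<noteq> 0" by (auto simp: composable_def)
    then have "b = gmult G (ginv G a) c" "grng G a = grng G c" "f a \<noteq> 0"
      by (auto simp: inv_mult_cancel rng_mult')
    then show "z \<in> ?p ` ?F" using z supp by auto
  next
    fix z assume "z \<in> ?p ` ?F"
    then show "z \<in> ?S"
      using F(2) c
      by (auto simp: composable_def mult_inv_cancel mult_arrows rng_mult' inv_closed dom_inv rng_inv subset_iff)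
  qed
  moreover have "inj_on ?p ?F" by (auto simp: inj_on_def)
  ultimately have "convolution G f h c = (\<Sum>a\<in>?F. f a * h (gmult G (ginv G a) c))"
    unfolding convolution_def by (simp add: sum.reindex)
  also have "\<dots> = (\<Sum>a\<in>F. f a * h (gmult G (ginv G a) c))"
    using F(1) by (intro sum.mono_neutral_left) auto
  finally show ?thesis .
qed

lemma convolution_zero [simp]: "convolution G 0 h = 0" "convolution G f 0 = 0"
  by (auto simp: convolution_def fun_eq_iff)

lemma convolution_add_left:
  assumes "f \<in> steinberg_algebra G" "g \<in> steinberg_algebra G"
  shows "convolution G (f + g) h = convolution G f h + convolution G g h"
proof
  fix c
  show "convolution G (f + g) h c = (convolution G f h + convolution G g h) c"
  proof (cases "c \<in> arrows G")
    case True
    let ?F = "{a. grng G a = grng G c \<and> f a \<noteq> 0} \<union> {a. grng G a = grng G c \<and> g a \<noteq> 0}"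
    have F: "finite ?F" using assms finite_support_rng by blast
    have sub: "?F \<subseteq> {a \<in> arrows G. grng G a = grng G c}" using assms steinberg_outside by blast
    \<comment> \<open>To be used for f, g and their sum, all over the same index set.\<close>
    have "convolution G f' h c = (\<Sum>a\<in>?F. f' a * h (gmult G (ginv G a) c))"
      if "\<And>a. f a = 0 \<Longrightarrow> g a = 0 \<Longrightarrow> f' a = 0" for f'
      using that by (intro convolution_sum[OF True F sub]) auto
    then show ?thesis by (simp add: sum.distrib[symmetric] distrib_right)
  qed (simp add: convolution_outside)
qed

lemma convolution_scale_left:
  assumes "f \<in> steinberg_algebra G"
  shows "convolution G (fun_scale k f) h = fun_scale k (convolution G f h)"
proof
  fix c
  show "convolution G (fun_scale k f) h c = fun_scale k (convolution G f h) c"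
  proof (cases "c \<in> arrows G")
    case True
    let ?F = "{a. grng G a = grng G c \<and> f a \<noteq> 0}"
    have F: "finite ?F" using assms finite_support_rng by blast
    have sub: "?F \<subseteq> {a \<in> arrows G. grng G a = grng G c}" using assms steinberg_outside by blast
    have "convolution G f' h c = (\<Sum>a\<in>?F. f' a * h (gmult G (ginv G a) c))"
      if "\<And>a. f a = 0 \<Longrightarrow> f' a = 0" for f'
      using that by (intro convolution_sum[OF True F sub]) auto
    then show ?thesis by (simp add: fun_scale_def sum_distrib_left mult.assoc)
  qed (simp add: convolution_outside fun_scale_def)
qed

lemma convolution_add_right:
  assumes "f \<in> steinberg_algebra G"
  shows "convolution G f (g + h) = convolution G f g + convolution G f h"
proof
  fix c
  show "convolution G f (g + h) c = (convolution G f g + convolution G f h) c"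
  proof (cases "c \<in> arrows G")
    case True
    let ?F = "{a. grng G a = grng G c \<and> f a \<noteq> 0}"
    have F: "finite ?F" using assms finite_support_rng by blast
    have sub: "?F \<subseteq> {a \<in> arrows G. grng G a = grng G c}" using assms steinberg_outside by blast
    have "convolution G f h' c = (\<Sum>a\<in>?F. f a * h' (gmult G (ginv G a) c))" for h'
      by (intro convolution_sum[OF True F sub]) auto
    then show ?thesis by (simp add: sum.distrib[symmetric] distrib_left)
  qed (simp add: convolution_outside)
qed

lemma convolution_scale_right:
  assumes "f \<in> steinberg_algebra G"
  shows "convolution G f (fun_scale k h) = fun_scale k (convolution G f h)"
proof
  fix c
  show "convolution G f (fun_scale k h) c = fun_scale k (convolution G f h) c"
  proof (cases "c \<in> arrows G")
    case True
    let ?F = "{a. grng G a = grng G c \<and> f a \<noteq> 0}"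
    have F: "finite ?F" using assms finite_support_rng by blast
    have sub: "?F \<subseteq> {a \<in> arrows G. grng G a = grng G c}" using assms steinberg_outside by blast
    have "convolution G f h' c = (\<Sum>a\<in>?F. f a * h' (gmult G (ginv G a) c))" for h'
      by (intro convolution_sum[OF True F sub]) auto
    then show ?thesis by (simp add: fun_scale_def sum_distrib_left mult.left_commute)
  qed (simp add: convolution_outside fun_scale_def)
qed

text \<open>Injectivity of r on U leaves a as the only possible first factor, so the sum has a
  single term.\<close>

lemma convolution_indicator:
  assumes U: "local_bisection G U" and "a \<in> U" "c \<in> arrows G" "grng G a = grng G c"
  shows "convolution G (indicator U) h c = h (gmult G (ginv G a) c)"
proof -
  have "a \<in> arrows G" using U assms(2) local_bisection_arrows by blast
  then have "convolution G (indicator U) h c = (\<Sum>a\<in>{a}. indicator U a * h (gmult G (ginv G a) c))"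
    using assms by (intro convolution_sum) (auto simp: indicator_def intro: local_bisection_rngD[OF U])
  then show ?thesis using assms(2) by simp
qed

lemma convolution_indicator_0:
  assumes "grng G c \<notin> grng G ` U"
  shows "convolution G (indicator U) h c = 0"
proof -
  have "a \<notin> U" if "(a, b) \<in> composable G" "gmult G a b = c" for a b
    using assms rng_mult[OF that(1)] that(2) by force
  then show ?thesis unfolding convolution_def by (intro sum.neutral) (auto simp: indicator_def)
qed

lemma convolution_indicator_units:
  assumes Z: "local_bisection G Z" "Z \<subseteq> units G" and c: "c \<in> arrows G"
  shows "convolution G (indicator Z) h c = (if grng G c \<in> Z then h c else 0)"
proof (cases "grng G c \<in> Z")
  case True
  then have "convolution G (indicator Z) h c = h (gmult G (ginv G (grng G c)) c)"
    using Z c by (intro convolution_indicator) (auto simp: rng_rng)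
  then show ?thesis using True c by (simp add: inv_unit rng_in_units rng_mult_left)
next
  case False
  then have "grng G c \<notin> grng G ` Z" using Z(2) by (auto simp: rng_unit subset_iff)
  then show ?thesis using False by (simp add: convolution_indicator_0)
qed

text \<open>The factor taken from U is determined by r(c), so no multiplicity greater than one can
  occur.\<close>

lemma convolution_indicators:
  assumes U: "local_bisection G U" and V: "V \<subseteq> arrows G"
  shows "convolution G (indicator U) (indicator V) = (indicator (setmult U V) :: 'a \<Rightarrow> 'k::comm_ring_1)"
proof
  fix c
  have Ua: "U \<subseteq> arrows G" using U by (rule local_bisection_arrows)
  consider "c \<notin> arrows G" | "grng G c \<notin> grng G ` U"
    | a where "c \<in> arrows G" "a \<in> U" "grng G a = grng G c" by force
  then show "convolution G (indicator U) (indicator V) c = (indicator (setmult U V) c :: 'k)"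
  proof cases
    case 1
    then have "c \<notin> setmult U V" using Ua V mult_arrows by (auto simp: setmult_def subset_iff)
    then show ?thesis using 1 by (simp add: convolution_outside)
  next
    case 2
    then have "c \<notin> setmult U V" using Ua V by (auto simp: setmult_def rng_mult' subset_iff image_iff)
    then show ?thesis using 2 by (simp add: convolution_indicator_0)
  next
    case 3
    have a: "a \<in> arrows G" using 3 Ua by blast
    have "gmult G (ginv G a) c \<in> V \<longleftrightarrow> c \<in> setmult U V"
    proof
      assume "gmult G (ginv G a) c \<in> V"
      then have "gmult G a (gmult G (ginv G a) c) \<in> setmult U V"
        using 3 a by (intro setmultI) (auto simp: rng_mult' inv_closed dom_inv rng_inv)
      then show "c \<in> setmult U V" using 3 a by (simp add: mult_inv_cancel)
    next
      assume "c \<in> setmult U V"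
      then obtain a' b where ab: "a' \<in> U" "b \<in> V" "gdom G a' = grng G b" "c = gmult G a' b"
        by (auto simp: setmult_def)
      then have ar: "a' \<in> arrows G" "b \<in> arrows G" using Ua V by auto
      then have "grng G a' = grng G a" using 3 ab by (simp add: rng_mult')
      then have "a' = a" using local_bisection_rngD[OF U ab(1) 3(2)] by simp
      then show "gmult G (ginv G a) c \<in> V" using ab ar by (simp add: inv_mult_cancel)
    qed
    then show ?thesis unfolding convolution_indicator[OF U 3(2,1,3)] by (simp add: indicator_def)
  qed
qed

text \<open>Bilinearity reduces the claim to two indicators, hence to the fact that products of
  compact bisections are compact bisections.\<close>

lemma convolution_closed:
  assumes f: "f \<in> steinberg_algebra G" and g: "g \<in> steinberg_algebra G"
  shows "convolution G f g \<in> steinberg_algebra G"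
  using f
proof (induction rule: steinberg_induct)
  case zero
  show ?case unfolding convolution_zero by (rule fun_module.subspace_0[OF steinberg_subspace])
next
  case (indicator U)
  show ?case using g
  proof (induction rule: steinberg_induct)
    case zero
    show ?case unfolding convolution_zero by (rule fun_module.subspace_0[OF steinberg_subspace])
  next
    case (indicator V)
    then show ?case
      using \<open>compact_bisection U\<close>
      by (simp add: convolution_indicators steinberg_indicator compact_bisection_setmult
          compact_bisection_local local_bisection_arrows)
  next
    case (add f g)
    then show ?case
      unfolding convolution_add_right[OF steinberg_indicator[OF \<open>compact_bisection U\<close>]]
      by (intro fun_module.subspace_add[OF steinberg_subspace])
  next
    case (scale c f)
    then show ?case
      unfolding convolution_scale_right[OF steinberg_indicator[OF \<open>compact_bisection U\<close>]]
      by (intro fun_module.subspace_scale[OF steinberg_subspace])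
  qed
next
  case (add f g)
  show ?case
    unfolding convolution_add_left[OF add.hyps]
    by (rule fun_module.subspace_add[OF steinberg_subspace add.IH])
next
  case (scale c f)
  show ?case
    unfolding convolution_scale_left[OF scale.hyps]
    by (rule fun_module.subspace_scale[OF steinberg_subspace scale.IH])
qed

text \<open>The involution induced by inversion, without conjugation of coefficients. The value 0
  outside the arrows is prescribed because \<open>ginv\<close> is unconstrained there.\<close>

definition star :: "('a \<Rightarrow> 'k::comm_ring_1) \<Rightarrow> 'a \<Rightarrow> 'k" where
  "star f = (\<lambda>c. if c \<in> arrows G then f (ginv G c) else 0)"

lemma star_star: "f \<in> steinberg_algebra G \<Longrightarrow> star (star f) = f"
  by (auto simp: star_def fun_eq_iff inv_inv inv_closed steinberg_outside)

lemma star_closed: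
  assumes "f \<in> steinberg_algebra G"
  shows "star f \<in> steinberg_algebra G"
  using assms
proof (induction rule: steinberg_induct)
  case zero
  have "star 0 = (0 :: 'a \<Rightarrow> 'b)" by (auto simp: star_def)
  then show ?case using steinberg_subspace by (metis fun_module.subspace_0)
next
  case (indicator U)
  then have "U \<subseteq> arrows G" by (simp add: compact_bisection_local local_bisection_arrows)
  then have "c \<in> ginv G ` U \<longleftrightarrow> c \<in> arrows G \<and> ginv G c \<in> U" for c
    using inv_inv inv_closed by (metis (no_types, lifting) image_iff subsetD)
  then have "star (indicator U) = (indicator (ginv G ` U) :: 'a \<Rightarrow> 'b)"
    by (auto simp: star_def fun_eq_iff indicator_def)
  then show ?case using indicator by (simp add: steinberg_indicator compact_bisection_inv)
next
  case (add f g)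
  have "star (f + g) = star f + star g" by (auto simp: star_def fun_eq_iff)
  then show ?case using fun_module.subspace_add[OF steinberg_subspace add.IH] by (simp only:)
next
  case (scale c f)
  have "star (fun_scale c f) = fun_scale c (star f)" by (auto simp: star_def fun_eq_iff fun_scale_def)
  then show ?case using fun_module.subspace_scale[OF steinberg_subspace scale.IH] by (simp only:)
qed

text \<open>Factorizations of c^-1 and of c correspond by sending (a, b) to (b^-1, a^-1);
  commutativity of the coefficients matches the terms.\<close>

lemma star_convolution: "star (convolution G f h) = convolution G (star h) (star f)"
proof
  fix c
  show "star (convolution G f h) c = convolution G (star h) (star f) c"
  proof (cases "c \<in> arrows G")
    case True
    let ?p = "\<lambda>(a, b). (ginv G b, ginv G a)"
    let ?S = "{(a, b) \<in> composable G. gmult G a b = ginv G c \<and> f a * h b \<noteq> 0}"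
    let ?T = "{(a, b) \<in> composable G. gmult G a b = c \<and> star h a * star f b \<noteq> 0}"
    have "(\<Sum>(a, b)\<in>?S. f a * h b) = (\<Sum>(a, b)\<in>?T. star h a * star f b)"
    proof (rule sum.reindex_bij_witness[where i = ?p and j = ?p])
      fix z assume "z \<in> ?S"
      then obtain a b where z: "z = (a, b)" "a \<in> arrows G" "b \<in> arrows G" "gdom G a = grng G b"
        "gmult G a b = ginv G c" "f a * h b \<noteq> 0" by (auto simp: composable_def)
      have "gmult G (ginv G b) (ginv G a) = c"
        using z True inv_mult_distrib[of a b] by (simp add: inv_inv)
      then show "?p z \<in> ?T" "?p (?p z) = z" "(case ?p z of (a, b) \<Rightarrow> star h a * star f b) = (case z of (a, b) \<Rightarrow> f a * h b)"
        using z by (simp_all add: composable_def inv_inv inv_closed dom_inv rng_inv star_def mult.commute)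
    next
      fix z assume "z \<in> ?T"
      then obtain a b where z: "z = (a, b)" "a \<in> arrows G" "b \<in> arrows G" "gdom G a = grng G b"
        "gmult G a b = c" "star h a * star f b \<noteq> 0" by (auto simp: composable_def)
      then show "?p z \<in> ?S" "?p (?p z) = z"
        using inv_mult_distrib[of a b]
        by (simp_all add: composable_def inv_inv inv_closed dom_inv rng_inv star_def mult.commute)
    qed
    then show ?thesis using True by (simp add: star_def convolution_def)
  qed (simp add: star_def convolution_outside)
qed

text \<open>Since \<open>star\<close> reverses products, right multiplication is left multiplication
  conjugated by \<open>star\<close>. Linearity in the left factor then leaves only products with
  indicators to check, which for each concrete ideal is a translation argument.\<close>

lemma two_sided_idealI:
  assumes sub: "I \<subseteq> steinberg_algebra G" and I: "fun_module.subspace I"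
    and st: "\<And>f. f \<in> I \<Longrightarrow> star f \<in> I"
    and left: "\<And>U f. compact_bisection U \<Longrightarrow> f \<in> I \<Longrightarrow> convolution G (indicator U) f \<in> I"
  shows "two_sided_ideal (convolution G) (steinberg_algebra G) I"
proof -
  have l: "convolution G f g \<in> I" if "f \<in> steinberg_algebra G" "g \<in> I" for f g
    using that(1)
  proof (induction rule: steinberg_induct)
    case zero
    show ?case unfolding convolution_zero by (rule fun_module.subspace_0[OF I])
  next
    case (indicator U)
    then show ?case using left that(2) by blast
  next
    case (add f h)
    show ?case
      unfolding convolution_add_left[OF add.hyps] by (rule fun_module.subspace_add[OF I add.IH])
  next
    case (scale c f)
    show ?case
      unfolding convolution_scale_left[OF scale.hyps] by (rule fun_module.subspace_scale[OF I scale.IH])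
  qed
  moreover have "convolution G g f \<in> I" if "f \<in> steinberg_algebra G" "g \<in> I" for f g
  proof -
    have "star (convolution G (star f) (star g)) = convolution G g f"
      using that sub by (simp add: star_convolution star_star subset_iff)
    then show ?thesis using l[of "star f" "star g"] that st star_closed by metis
  qed
  ultimately show ?thesis using sub I by (simp add: two_sided_ideal_def)
qed

end

section \<open>Ideals of a simple Steinberg algebra\<close>

context etale_groupoid
begin

text \<open>Stated through open subsets of the support because these can be transported by inversion
  and by translation along bisections.\<close>

lemma singular_iff:
  "f \<in> singular_functions G \<longleftrightarrow> f \<in> steinberg_algebra G \<and>
    \<not> (\<exists>W. openin (gtop G) W \<and> W \<noteq> {} \<and> (\<forall>x\<in>W. f x \<noteq> 0))"
  unfolding singular_functions_def interior_of_def by blast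

text \<open>W must be arbitrary in the induction: for a sum, the open set found for f is the one in
  which the set for g is sought. Constancy near a prescribed point can fail at the boundary of a
  compact bisection, which is why V is merely some open subset of W.\<close>

lemma steinberg_constant_on_open:
  assumes "f \<in> steinberg_algebra G" "openin (gtop G) W" "W \<noteq> {}"
  shows "\<exists>V k. openin (gtop G) V \<and> V \<noteq> {} \<and> V \<subseteq> W \<and> (\<forall>x\<in>V. f x = k)"
  using assms
proof (induction arbitrary: W rule: steinberg_induct)
  case zero
  then show ?case by (intro exI[of _ W]) auto
next
  case (indicator U)
  have U: "openin (gtop G) U"
    using indicator(1) by (simp add: compact_bisection_def local_bisection_iff)
  show ?case
  proof (cases "W \<inter> U = {}")
    case True
    then show ?thesis using indicator(2,3)
      by (intro exI[of _ W] exI[of _ 0]) (auto simp: indicator_def)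
  next
    case False
    then show ?thesis using indicator(2) U
      by (intro exI[of _ "W \<inter> U"] exI[of _ 1]) auto
  qed
next
  case (add f g)
  obtain V k where V: "openin (gtop G) V" "V \<noteq> {}" "V \<subseteq> W" "\<forall>x\<in>V. f x = k"
    using add.IH(1)[OF add.prems] by blast
  obtain V' k' where "openin (gtop G) V'" "V' \<noteq> {}" "V' \<subseteq> V" "\<forall>x\<in>V'. g x = k'"
    using add.IH(2)[OF V(1,2)] by blast
  with V show ?case by (intro exI[of _ V'] exI[of _ "k + k'"]) auto
next
  case (scale c f)
  obtain V k where "openin (gtop G) V" "V \<noteq> {}" "V \<subseteq> W" "\<forall>x\<in>V. f x = k"
    using scale.IH[OF scale.prems] by blast
  then show ?case by (intro exI[of _ V] exI[of _ "c * k"]) (auto simp: fun_scale_def)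
qed

text \<open>A non-zero constant would put an open set inside the support. Singularity itself gives
  only a zero in each open set; a whole open set of zeros is what makes sums of singular functions
  singular.\<close>

lemma singular_zero_on_open:
  assumes "f \<in> singular_functions G" "openin (gtop G) W" "W \<noteq> {}"
  shows "\<exists>V. openin (gtop G) V \<and> V \<noteq> {} \<and> V \<subseteq> W \<and> (\<forall>x\<in>V. f x = 0)"
proof -
  have f: "f \<in> steinberg_algebra G" using assms(1) by (simp add: singular_iff)
  obtain V k where V: "openin (gtop G) V" "V \<noteq> {}" "V \<subseteq> W" "\<forall>x\<in>V. f x = k"
    using steinberg_constant_on_open[OF f assms(2,3)] by (elim exE conjE)
  then have "k = 0" using assms(1) unfolding singular_iff by (cases "k = 0") auto
  with V show ?thesis by blast
qed

lemma singular_ideal: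
  "two_sided_ideal (convolution G) (steinberg_algebra G)
    (singular_functions G :: ('a \<Rightarrow> 'k::comm_ring_1) set)" (is "two_sided_ideal _ _ ?S")
proof (rule two_sided_idealI)
  show "?S \<subseteq> steinberg_algebra G" by (auto simp: singular_functions_def)
next
  show "fun_module.subspace ?S"
  proof (rule fun_module.subspaceI)
    show "0 \<in> ?S"
      using fun_module.subspace_0[OF steinberg_subspace] unfolding singular_iff by auto
  next
    fix f g :: "'a \<Rightarrow> 'k"
    assume f: "f \<in> singular_functions G" and g: "g \<in> singular_functions G"
    have "\<exists>x\<in>W. (f + g) x = 0" if W: "openin (gtop G) W" "W \<noteq> {}" for W
    proof -
      obtain V where V: "openin (gtop G) V" "V \<noteq> {}" "V \<subseteq> W" "\<forall>x\<in>V. f x = 0"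
        using singular_zero_on_open[OF f W] by blast
      obtain V' where V': "V' \<noteq> {}" "V' \<subseteq> V" "\<forall>x\<in>V'. g x = 0"
        using singular_zero_on_open[OF g V(1,2)] by blast
      then obtain x where "x \<in> V'" by blast
      then have "x \<in> W" "(f + g) x = 0" using V V' by auto
      then show ?thesis by blast
    qed
    moreover have "f + g \<in> steinberg_algebra G"
      using f g fun_module.subspace_add[OF steinberg_subspace] unfolding singular_iff by blast
    ultimately show "f + g \<in> singular_functions G" unfolding singular_iff by blast
  next
    fix k :: 'k and f :: "'a \<Rightarrow> 'k"
    assume f: "f \<in> singular_functions G"
    moreover from this have "fun_scale k f \<in> steinberg_algebra G"
      using fun_module.subspace_scale[OF steinberg_subspace] unfolding singular_iff by blast
    moreover have "f x \<noteq> 0" if "fun_scale k f x \<noteq> 0" for x using that by (auto simp: fun_scale_def)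
    ultimately show "fun_scale k f \<in> singular_functions G" unfolding singular_iff by blast
  qed
next
  fix f :: "'a \<Rightarrow> 'k"
  assume f: "f \<in> singular_functions G"
  have False if W: "openin (gtop G) W" "W \<noteq> {}" "\<forall>x\<in>W. star f x \<noteq> 0" for W
  proof -
    have "openin (gtop G) (ginv G ` W)" "ginv G ` W \<noteq> {}" using W open_image_inv by auto
    moreover have "\<forall>x\<in>ginv G ` W. f x \<noteq> 0" using W(3) by (auto simp: star_def split: if_splits)
    ultimately show False using f unfolding singular_iff by blast
  qed
  then show "star f \<in> singular_functions G"
    using f star_closed unfolding singular_iff by blast
next
  fix U and f :: "'a \<Rightarrow> 'k"
  assume U: "compact_bisection U" and f: "f \<in> singular_functions G"
  have Ul: "local_bisection G U" using U by (rule compact_bisection_local)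
  have Ua: "U \<subseteq> arrows G" using Ul by (rule local_bisection_arrows)
  have False if W: "openin (gtop G) W" "W \<noteq> {}" "\<forall>c\<in>W. convolution G (indicator U) f c \<noteq> 0" for W
  proof -
    have Wa: "W \<subseteq> arrows G" using W(1) by (rule openin_arrows)
    have ex: "\<exists>a\<in>U. grng G a = grng G c" if "c \<in> W" for c
      using W(3) that convolution_indicator_0[of c U f] by (metis image_iff)
    \<comment> \<open>An open set on which the product does not vanish is translated by U^-1 to an
      open set on which f does not vanish.\<close>
    let ?W = "setmult (ginv G ` U) W"
    have "openin (gtop G) ?W" using open_setmult local_bisection_inv Ul W(1) by blast
    moreover have "?W \<noteq> {}"
    proof -
      obtain c where c: "c \<in> W" using W(2) by blast
      then obtain a where "a \<in> U" "grng G a = grng G c" using ex by blast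
      then have "gmult G (ginv G a) c \<in> ?W" using c Ua by (intro setmultI) (auto simp: dom_inv)
      then show ?thesis by blast
    qed
    moreover have "f x \<noteq> 0" if x: "x \<in> ?W" for x
    proof -
      obtain a c where ac: "a \<in> U" "c \<in> W" "gdom G (ginv G a) = grng G c" "x = gmult G (ginv G a) c"
        using x by (auto simp: setmult_def)
      then have "grng G a = grng G c" "c \<in> arrows G" using Ua Wa by (auto simp: dom_inv subset_iff)
      then have "convolution G (indicator U) f c = f x"
        unfolding ac(4) by (intro convolution_indicator[OF Ul ac(1)])
      then show ?thesis using bspec[OF W(3) ac(2)] by simp
    qed
    ultimately show False using f unfolding singular_iff by blast
  qed
  moreover have "convolution G (indicator U) f \<in> steinberg_algebra G"
    using f convolution_closed[OF steinberg_indicator[OF U]] unfolding singular_iff by blast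
  ultimately show "convolution G (indicator U) f \<in> singular_functions G" unfolding singular_iff by blast
qed

text \<open>Composing an arrow from x to d(a) with a gives an arrow from x to r(a); the converse
  applies this to a^-1. This symmetry is what lets a vanishing condition on domains survive
  \<open>star\<close>.\<close>

lemma orbit_dom_iff_rng:
  assumes a: "a \<in> arrows G"
  shows "gdom G a \<in> orbit G x \<longleftrightarrow> grng G a \<in> orbit G x"
proof -
  have *: "grng G a \<in> orbit G x" if a: "a \<in> arrows G" and d: "gdom G a \<in> orbit G x" for a
  proof -
    obtain g where "g \<in> arrows G" "gdom G g = x" "gdom G a = grng G g"
      using d by (auto simp: orbit_def)
    then show ?thesis using a
      by (auto simp: orbit_def mult_arrows rng_mult' dom_mult' intro!: exI[of _ "gmult G a g"])
  qed
  show ?thesis using *[OF a] *[OF inv_closed[OF a]] a by (auto simp: dom_inv rng_inv)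
qed

text \<open>Left translation does not change the domain of an arrow, so left multiplication
  preserves the condition; \<open>star\<close> does so by invariance of the orbit.\<close>

lemma vanishing_ideal:
  "two_sided_ideal (convolution G) (steinberg_algebra G)
    {f \<in> steinberg_algebra G. \<forall>c\<in>arrows G. gdom G c \<in> orbit G x \<longrightarrow> f c = 0}" (is "two_sided_ideal _ _ ?I")
proof (rule two_sided_idealI)
  show "?I \<subseteq> steinberg_algebra G" by blast
  show "fun_module.subspace ?I"
    using steinberg_subspace unfolding fun_module.subspace_def by (auto simp: fun_scale_def)
  show "star f \<in> ?I" if f: "f \<in> ?I" for f
  proof -
    have "star f c = 0" if c: "c \<in> arrows G" "gdom G c \<in> orbit G x" for c
    proof -
      have "gdom G (ginv G c) \<in> orbit G x" using c orbit_dom_iff_rng[OF c(1)] by (simp add: dom_inv)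
      then show ?thesis using f c inv_closed by (simp add: star_def)
    qed
    then show ?thesis using f star_closed by blast
  qed
  show "convolution G (indicator U) f \<in> ?I" if U: "compact_bisection U" and f: "f \<in> ?I" for U f
  proof -
    have "convolution G (indicator U) f c = 0" if c: "c \<in> arrows G" "gdom G c \<in> orbit G x" for c
    proof (cases "\<exists>a\<in>U. grng G a = grng G c")
      case True
      then obtain a where a: "a \<in> U" "grng G a = grng G c" by blast
      then have "a \<in> arrows G"
        using U local_bisection_arrows compact_bisection_local by blast
      then have "f (gmult G (ginv G a) c) = 0"
        using f c a(2) by (simp add: mult_arrows dom_mult' inv_closed dom_inv)
      then show ?thesis
        using convolution_indicator[OF compact_bisection_local[OF U] a(1) c(1) a(2), of f] by simp
    qed (use convolution_indicator_0[of c U f] in force)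
    moreover have "convolution G (indicator U) f \<in> steinberg_algebra G"
      using f convolution_closed[OF steinberg_indicator[OF U]] by blast
    ultimately show ?thesis by blast
  qed
qed

text \<open>
  The matrix through which \<open>f\<close> acts on functions on the unit space.
\<close>

definition fibre_sum :: "('a \<Rightarrow> 'k::comm_ring_1) \<Rightarrow> 'a \<Rightarrow> 'a \<Rightarrow> 'k" where
  "fibre_sum f x y = (\<Sum>g | gdom G g = x \<and> grng G g = y \<and> f g \<noteq> 0. f g)"

lemma fibre_sum_eq:
  assumes "finite F" "F \<subseteq> {g. gdom G g = x \<and> grng G g = y}"
    and "{g. gdom G g = x \<and> grng G g = y \<and> f g \<noteq> 0} \<subseteq> F"
  shows "fibre_sum f x y = sum f F"
  unfolding fibre_sum_def using assms by (intro sum.mono_neutral_left) auto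

lemma finite_fibre:
  assumes "f \<in> steinberg_algebra G"
  shows "finite {g. gdom G g = x \<and> grng G g = y \<and> f g \<noteq> 0}"
  by (rule finite_subset[OF _ finite_support_dom[OF assms, of x]]) auto

lemma fibre_sum_add:
  assumes "f \<in> steinberg_algebra G" "g \<in> steinberg_algebra G"
  shows "fibre_sum (f + g) x y = fibre_sum f x y + fibre_sum g x y"
proof -
  let ?F = "{a. gdom G a = x \<and> grng G a = y \<and> f a \<noteq> 0} \<union> {a. gdom G a = x \<and> grng G a = y \<and> g a \<noteq> 0}"
  have F: "finite ?F" using assms finite_fibre by blast
  have "fibre_sum f x y = sum f ?F" "fibre_sum g x y = sum g ?F" "fibre_sum (f + g) x y = sum (f + g) ?F"
    by (rule fibre_sum_eq[OF F]; auto)+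
  then show ?thesis by (simp add: sum.distrib)
qed

lemma fibre_sum_scale:
  assumes "f \<in> steinberg_algebra G"
  shows "fibre_sum (fun_scale k f) x y = k * fibre_sum f x y"
proof -
  let ?F = "{a. gdom G a = x \<and> grng G a = y \<and> f a \<noteq> 0}"
  have F: "finite ?F" using assms finite_fibre by blast
  have "fibre_sum f x y = sum f ?F" "fibre_sum (fun_scale k f) x y = sum (fun_scale k f) ?F"
    by (rule fibre_sum_eq[OF F]; auto simp: fun_scale_def)+
  then show ?thesis by (simp add: sum_distrib_left fun_scale_def)
qed

text \<open>At most one arrow of U starts at x: a bisection acts as a partial permutation
  matrix.\<close>

lemma fibre_sum_indicator:
  assumes U: "local_bisection G U"
  shows "fibre_sum (indicator U) x y = (if \<exists>a\<in>U. gdom G a = x \<and> grng G a = y then 1 else 0)"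
proof (cases "\<exists>a\<in>U. gdom G a = x \<and> grng G a = y")
  case True
  then obtain a where a: "a \<in> U" "gdom G a = x" "grng G a = y" by blast
  then have "fibre_sum (indicator U) x y = sum (indicator U) {a}"
    using local_bisection_domD[OF U] by (intro fibre_sum_eq) (auto simp: indicator_def)
  then show ?thesis using True a by simp
next
  case False
  then have "fibre_sum (indicator U) x y = sum (indicator U) {}"
    by (intro fibre_sum_eq) (auto simp: indicator_def)
  then show ?thesis unfolding if_not_P[OF False] by simp
qed

text \<open>Inversion exchanges the two ends of an arrow, so \<open>star\<close> transposes the
  matrix.\<close>

lemma fibre_sum_star:
  assumes f: "f \<in> steinberg_algebra G"
  shows "fibre_sum (star f) x y = fibre_sum f y x"
  unfolding fibre_sum_def
proof (rule sum.reindex_bij_witness[where i = "ginv G" and j = "ginv G"])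
  fix g assume "g \<in> {g. gdom G g = x \<and> grng G g = y \<and> star f g \<noteq> 0}"
  then have "g \<in> arrows G" "gdom G g = x" "grng G g = y" "f (ginv G g) \<noteq> 0"
    by (auto simp: star_def split: if_splits)
  then show "ginv G (ginv G g) = g" "ginv G g \<in> {g. gdom G g = y \<and> grng G g = x \<and> f g \<noteq> 0}"
    "f (ginv G g) = star f g"
    by (simp_all add: inv_inv dom_inv rng_inv star_def)
next
  fix g assume g: "g \<in> {g. gdom G g = y \<and> grng G g = x \<and> f g \<noteq> 0}"
  then have "g \<in> arrows G" using steinberg_outside[OF f] by blast
  then show "ginv G (ginv G g) = g" "ginv G g \<in> {g. gdom G g = x \<and> grng G g = y \<and> star f g \<noteq> 0}"
    using g by (simp_all add: inv_inv dom_inv rng_inv star_def inv_closed)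
qed

text \<open>Multiplication by a is a bijection from the arrows x to d(a) onto the arrows x to r(a),
  and it matches the values of f with those of the product.\<close>

lemma fibre_sum_convolution_indicator:
  assumes U: "local_bisection G U" and f: "f \<in> steinberg_algebra G" and a: "a \<in> U"
  shows "fibre_sum (convolution G (indicator U) f) x (grng G a) = fibre_sum f x (gdom G a)"
  unfolding fibre_sum_def
proof (rule sum.reindex_bij_witness[where i = "gmult G a" and j = "gmult G (ginv G a)"])
  have aa: "a \<in> arrows G" using U a local_bisection_arrows by blast
  { fix c assume c: "c \<in> {c. gdom G c = x \<and> grng G c = grng G a \<and> convolution G (indicator U) f c \<noteq> 0}"
    then have ca: "c \<in> arrows G" "gdom G c = x" "grng G a = grng G c" using convolution_outside by auto
    have e: "convolution G (indicator U) f c = f (gmult G (ginv G a) c)"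
      by (rule convolution_indicator[OF U a ca(1,3)])
    show "gmult G a (gmult G (ginv G a) c) = c" "f (gmult G (ginv G a) c) = convolution G (indicator U) f c"
      "gmult G (ginv G a) c \<in> {g. gdom G g = x \<and> grng G g = gdom G a \<and> f g \<noteq> 0}"
      using ca aa c e by (simp_all add: mult_inv_cancel dom_mult' rng_mult' inv_closed dom_inv rng_inv)
  }
  fix b assume b: "b \<in> {g. gdom G g = x \<and> grng G g = gdom G a \<and> f g \<noteq> 0}"
  then have ba: "b \<in> arrows G" "gdom G a = grng G b" using steinberg_outside[OF f] by auto
  have c: "gmult G a b \<in> arrows G" "grng G a = grng G (gmult G a b)"
    using aa ba by (simp_all add: mult_arrows rng_mult')
  have e: "convolution G (indicator U) f (gmult G a b) = f (gmult G (ginv G a) (gmult G a b))"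
    by (rule convolution_indicator[OF U a c])
  show "gmult G (ginv G a) (gmult G a b) = b"
    "gmult G a b \<in> {c. gdom G c = x \<and> grng G c = grng G a \<and> convolution G (indicator U) f c \<noteq> 0}"
    using aa ba b e by (simp_all add: inv_mult_cancel dom_mult' rng_mult')
qed

lemma fibre_sum_ideal:
  "two_sided_ideal (convolution G) (steinberg_algebra G)
    {f \<in> steinberg_algebra G. \<forall>x y. fibre_sum f x y = 0}" (is "two_sided_ideal _ _ ?I")
proof (rule two_sided_idealI)
  show "?I \<subseteq> steinberg_algebra G" by blast
  show "fun_module.subspace ?I"
  proof (rule fun_module.subspaceI)
    show "0 \<in> ?I" using fun_module.subspace_0[OF steinberg_subspace] by (simp add: fibre_sum_def)
    show "f + g \<in> ?I" if "f \<in> ?I" "g \<in> ?I" for f g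
      using that fun_module.subspace_add[OF steinberg_subspace, of f g] fibre_sum_add[of f g] by simp
    show "fun_scale k f \<in> ?I" if "f \<in> ?I" for k f
      using that fun_module.subspace_scale[OF steinberg_subspace, of f k] fibre_sum_scale[of f k] by simp
  qed
  show "star f \<in> ?I" if "f \<in> ?I" for f using that by (simp add: star_closed fibre_sum_star)
  show "convolution G (indicator U) f \<in> ?I" if U: "compact_bisection U" and f: "f \<in> ?I" for U f
  proof -
    have "fibre_sum (convolution G (indicator U) f) x y = 0" for x y
    proof (cases "y \<in> grng G ` U")
      case True
      then show ?thesis using f U fibre_sum_convolution_indicator compact_bisection_local by fastforce
    next
      case False
      then have "convolution G (indicator U) f c = 0" if "grng G c = y" for c
        using that convolution_indicator_0 by blast
      then show ?thesis unfolding fibre_sum_def by (intro sum.neutral) auto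
    qed
    moreover have "convolution G (indicator U) f \<in> steinberg_algebra G"
      using f convolution_closed[OF steinberg_indicator[OF U]] by blast
    ultimately show ?thesis by blast
  qed
qed

end

section \<open>Necessity of the three conditions\<close>

context ample_groupoid
begin

lemma unit_nbhd:
  assumes "x \<in> units G"
  obtains Z where "compact_bisection Z" "x \<in> Z" "Z \<subseteq> units G"
proof -
  have "openin (unit_space G) (units G)" by (simp add: openin_unit_space open_units)
  then show thesis using compact_open_nbhd_unit assms that by metis
qed

text \<open>The ideal is proper because the indicator of a non-empty compact open set of units has
  open support.\<close>

lemma simple_imp_singular_zero:
  assumes simple: "simple_algebra (convolution G) (steinberg_algebra G :: ('a \<Rightarrow> 'k::field) set)"
    and ne: "arrows G \<noteq> {}"
  shows "(singular_functions G :: ('a \<Rightarrow> 'k) set) = {0}"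
proof -
  obtain x where "x \<in> units G" using ne dom_in_units by blast
  then obtain Z where Z: "compact_bisection Z" "x \<in> Z" using unit_nbhd by blast
  then have "openin (gtop G) Z" by (simp add: compact_bisection_def local_bisection_iff)
  then have "(indicator Z :: 'a \<Rightarrow> 'k) \<notin> singular_functions G"
    using Z(2) unfolding singular_iff by force
  then have "singular_functions G \<noteq> (steinberg_algebra G :: ('a \<Rightarrow> 'k) set)"
    using steinberg_indicator[OF Z(1)] by metis
  then show ?thesis using simple singular_ideal unfolding simple_algebra_def by blast
qed

lemma simple_imp_minimal:
  assumes simple: "simple_algebra (convolution G) (steinberg_algebra G :: ('a \<Rightarrow> 'k::field) set)"
  shows "minimal_groupoid G"
  unfolding minimal_groupoid_def
proof
  fix x assume x: "x \<in> units G"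
  let ?I = "{f \<in> steinberg_algebra G. \<forall>c\<in>arrows G. gdom G c \<in> orbit G x \<longrightarrow> f c = 0} :: ('a \<Rightarrow> 'k) set"
  obtain Z where Z: "compact_bisection Z" "x \<in> Z" using x unit_nbhd by blast
  have "x \<in> orbit G x" using x units_arrows rng_unit dom_unit unfolding orbit_def by force
  moreover have "x \<in> arrows G" "gdom G x = x" using x units_arrows dom_unit by auto
  \<comment> \<open>The ideal is proper: x lies in its own orbit and is its own domain, and the
    indicator of Z is 1 there.\<close>
  ultimately have "(indicator Z :: 'a \<Rightarrow> 'k) \<notin> ?I" using Z(2) by (auto intro!: bexI[of _ x])
  then have "?I \<noteq> steinberg_algebra G" using steinberg_indicator[OF Z(1)] by metis
  then have I0: "?I = {0}" using simple vanishing_ideal unfolding simple_algebra_def by blast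
  have "T \<inter> orbit G x \<noteq> {}" if T: "openin (unit_space G) T" "T \<noteq> {}" for T
  proof
    assume disj: "T \<inter> orbit G x = {}"
    obtain y where "y \<in> T" using T by blast
    then obtain Y where Y: "compact_bisection Y" "y \<in> Y" "Y \<subseteq> T" "Y \<subseteq> units G"
      using compact_open_nbhd_unit T by metis
    \<comment> \<open>Members of Y are units, hence equal to their own domains, and they lie in T,
      which misses the orbit.\<close>
    then have "(indicator Y c :: 'k) = 0" if "gdom G c \<in> orbit G x" for c
      using that disj Y(3,4) dom_unit[of c] by (cases "c \<in> Y") (auto simp: subset_iff disjoint_iff)
    then have "(indicator Y :: 'a \<Rightarrow> 'k) \<in> ?I" using steinberg_indicator[OF Y(1)] by blast
    then have "(indicator Y :: 'a \<Rightarrow> 'k) = 0" using I0 by blast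
    then have "(indicator Y y :: 'k) = 0" by simp
    then show False using Y(2) by simp
  qed
  then show "unit_space G closure_of orbit G x = units G"
    using dense_intersects_open[of "unit_space G" "orbit G x"] by (auto simp: topspace_unit_space)
qed

lemma simple_imp_effective:
  assumes simple: "simple_algebra (convolution G) (steinberg_algebra G :: ('a \<Rightarrow> 'k::field) set)"
  shows "effective_groupoid G"
  unfolding effective_groupoid_def
proof
  have "units G \<subseteq> isotropy G" by (auto simp: isotropy_def units_arrows dom_unit rng_unit)
  then show "units G \<subseteq> gtop G interior_of isotropy G" using open_units by (rule interior_of_maximal)
  show "gtop G interior_of isotropy G \<subseteq> units G"
  proof (rule subsetI, rule ccontr)
    fix g assume g: "g \<in> gtop G interior_of isotropy G" "g \<notin> units G"
    then obtain U where U: "compact_bisection U" "g \<in> U" "U \<subseteq> gtop G interior_of isotropy G"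
      using compact_bisection_nbhd[of "gtop G interior_of isotropy G" g] by (metis openin_interior_of)
    then have iso: "gdom G a = grng G a" if "a \<in> U" for a
      using that interior_of_subset[of "gtop G" "isotropy G"] by (auto simp: isotropy_def)
    note D = compact_bisection_dom[OF U(1)]
    let ?I = "{f \<in> steinberg_algebra G. \<forall>x y. fibre_sum f x y = 0} :: ('a \<Rightarrow> 'k) set"
    let ?f = "indicator U + fun_scale (- 1) (indicator (gdom G ` U)) :: 'a \<Rightarrow> 'k"
    have m: "(indicator U :: 'a \<Rightarrow> 'k) \<in> steinberg_algebra G"
      "(indicator (gdom G ` U) :: 'a \<Rightarrow> 'k) \<in> steinberg_algebra G"
      using steinberg_indicator U(1) D(1) by blast+
    \<comment> \<open>Because U lies in the isotropy, the unit d(a) has the same ends as a, so U and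
      d(U) have the same matrix.\<close>
    have "gdom G (gdom G a) = gdom G a" "grng G (gdom G a) = grng G a" if "a \<in> U" for a
      using that D(2) iso[OF that] dom_unit[of "gdom G a"] rng_unit[of "gdom G a"] by auto
    then have "(\<exists>a\<in>gdom G ` U. gdom G a = x \<and> grng G a = y) \<longleftrightarrow> (\<exists>a\<in>U. gdom G a = x \<and> grng G a = y)" for x y
      by (simp cong: bex_cong)
    then have "fibre_sum ?f x y = 0" for x y
      unfolding fibre_sum_add[OF m(1) fun_module.subspace_scale[OF steinberg_subspace m(2)]]
        fibre_sum_scale[OF m(2)] fibre_sum_indicator[OF compact_bisection_local[OF U(1)]]
        fibre_sum_indicator[OF compact_bisection_local[OF D(1)]]
      by (simp only:) simp
    moreover have "?f \<in> steinberg_algebra G"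
      using m fun_module.subspace_scale[OF steinberg_subspace] fun_module.subspace_add[OF steinberg_subspace] by blast
    ultimately have fI: "?f \<in> ?I" by blast
    \<comment> \<open>At the non-unit g nothing cancels, since d(U) consists of units.\<close>
    have "?f g \<noteq> 0" using U(2) g(2) D(2) by (auto simp: fun_scale_def indicator_def)
    then have "?f \<noteq> 0" by (metis zero_fun_apply)
    then have "?I \<noteq> {0}" using fI by blast
    then have I: "?I = steinberg_algebra G" using simple fibre_sum_ideal unfolding simple_algebra_def by blast
    \<comment> \<open>A non-zero matrix entry keeps the indicator of U out of the kernel,
      contradicting that the kernel is everything.\<close>
    have "fibre_sum (indicator U :: 'a \<Rightarrow> 'k) (gdom G g) (grng G g) = 1"
      using U by (auto simp: fibre_sum_indicator compact_bisection_local)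
    then have "(indicator U :: 'a \<Rightarrow> 'k) \<notin> ?I" by force
    then show False using m(1) I by metis
  qed
qed

section \<open>Ideals of an effective minimal groupoid\<close>

text \<open>If some g in U with d(g) in Z has distinct ends, separate them by disjoint open sets M
  and N and keep those units of Z and M at which arrows of U with range in N start. Any arrow of U
  starting there ends in N, hence outside M. Otherwise the part of U over Z is open and inside the
  isotropy, and effectiveness puts it into the units.\<close>

lemma effective_shrink:
  assumes eff: "effective_groupoid G" and U: "local_bisection G U"
    and Z: "openin (unit_space G) Z" "Z \<noteq> {}"
  shows "\<exists>Z'. openin (unit_space G) Z' \<and> Z' \<noteq> {} \<and> Z' \<subseteq> Z \<and>
    (\<forall>g\<in>U. gdom G g \<in> Z' \<and> grng G g \<in> Z' \<longrightarrow> g \<in> units G)"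
proof (cases "\<exists>g\<in>U. gdom G g \<in> Z \<and> gdom G g \<noteq> grng G g")
  case True
  then obtain g where g: "g \<in> U" "gdom G g \<in> Z" "gdom G g \<noteq> grng G g" by blast
  then have "gdom G g \<in> topspace (unit_space G)" "grng G g \<in> topspace (unit_space G)"
    using local_bisection_arrows[OF U] dom_in_units rng_in_units by (auto simp: topspace_unit_space)
  then obtain M N where MN: "openin (unit_space G) M" "openin (unit_space G) N"
    "gdom G g \<in> M" "grng G g \<in> N" "disjnt M N"
    using Hausdorff_units g(3) unfolding Hausdorff_space_def by blast
  let ?V = "U \<inter> {a \<in> arrows G. grng G a \<in> N}"
  have "openin (gtop G) {a \<in> arrows G. grng G a \<in> N}"
    using openin_continuous_map_preimage[OF continuous_rng MN(2)] by (simp add: arrows_def)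
  then have "openin (gtop G) ?V" using U by (auto simp: local_bisection_iff)
  then have "openin (unit_space G) (gdom G ` ?V)" using open_map_dom open_map_def by blast
  then have "openin (unit_space G) (Z \<inter> M \<inter> gdom G ` ?V)" using Z MN by blast
  moreover have "gdom G g \<in> Z \<inter> M \<inter> gdom G ` ?V"
    using g MN local_bisection_arrows[OF U] by blast
  moreover have False if h: "h \<in> U" "gdom G h \<in> gdom G ` ?V" "grng G h \<in> M" for h
  proof -
    obtain k where "k \<in> ?V" "gdom G h = gdom G k" using h(2) by blast
    then have "grng G h \<in> N" using local_bisection_domD[OF U h(1), of k] by blast
    then show False using h(3) MN(5) by (auto simp: disjnt_iff)
  qed
  ultimately show ?thesis by (intro exI[of _ "Z \<inter> M \<inter> gdom G ` ?V"]) blast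
next
  case False
  let ?V = "U \<inter> {a \<in> arrows G. gdom G a \<in> Z}"
  have "openin (gtop G) {a \<in> arrows G. gdom G a \<in> Z}"
    using openin_continuous_map_preimage[OF continuous_dom Z(1)] by (simp add: arrows_def)
  then have "openin (gtop G) ?V" using U by (auto simp: local_bisection_iff)
  moreover have "?V \<subseteq> isotropy G" using False by (auto simp: isotropy_def)
  ultimately have "?V \<subseteq> units G"
    using eff interior_of_maximal unfolding effective_groupoid_def by metis
  then show ?thesis using Z local_bisection_arrows[OF U] by (intro exI[of _ Z]) blast
qed

text \<open>The conclusion is inherited by smaller sets, so the bisections can be treated one after
  another, each step keeping the set open and non-empty.\<close>

lemma effective_shrink_finite:
  assumes eff: "effective_groupoid G" and "finite F" "\<forall>U\<in>F. local_bisection G U"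
    and Z: "openin (unit_space G) Z" "Z \<noteq> {}"
  shows "\<exists>Z'. openin (unit_space G) Z' \<and> Z' \<noteq> {} \<and> Z' \<subseteq> Z \<and>
    (\<forall>g\<in>\<Union>F. gdom G g \<in> Z' \<and> grng G g \<in> Z' \<longrightarrow> g \<in> units G)"
  using assms(2,3)
proof (induction rule: finite_induct)
  case empty
  then show ?case using Z by auto
next
  case (insert U F)
  then obtain Z' where Z': "openin (unit_space G) Z'" "Z' \<noteq> {}" "Z' \<subseteq> Z"
    "\<forall>g\<in>\<Union>F. gdom G g \<in> Z' \<and> grng G g \<in> Z' \<longrightarrow> g \<in> units G" by auto
  have "local_bisection G U" using insert.prems by simp
  then obtain Z'' where "openin (unit_space G) Z''" "Z'' \<noteq> {}" "Z'' \<subseteq> Z'"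
    "\<forall>g\<in>U. gdom G g \<in> Z'' \<and> grng G g \<in> Z'' \<longrightarrow> g \<in> units G"
    using effective_shrink[OF eff _ Z'(1,2)] by blast
  then show ?case using Z' by (intro exI[of _ Z'']) blast
qed

lemma convolution_indicator_units_right:
  assumes f: "f \<in> steinberg_algebra G" and Z: "compact_bisection Z" "Z \<subseteq> units G" and c: "c \<in> arrows G"
  shows "convolution G f (indicator Z) c = (if gdom G c \<in> Z then f c else 0)"
proof -
  have "ginv G a \<in> Z \<longleftrightarrow> a \<in> Z" if "a \<in> arrows G" for a
    using that Z(2) inv_unit[of a] inv_unit[of "ginv G a"] inv_inv[of a] by auto
  \<comment> \<open>A set of units is fixed by inversion, so the right-hand formula follows from the
    left-hand one through \<open>star\<close>.\<close>
  then have s: "star (indicator Z) = indicator Z"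
    using Z(2) units_arrows by (auto simp: star_def fun_eq_iff indicator_def)
  have "convolution G f (indicator Z) = star (star (convolution G f (indicator Z)))"
    using star_star[OF convolution_closed[OF f steinberg_indicator[OF Z(1)]]] by simp
  also have "\<dots> = star (convolution G (indicator Z) (star f))" by (simp add: star_convolution s)
  finally have "convolution G f (indicator Z) c = convolution G (indicator Z) (star f) (ginv G c)"
    using c by (simp add: star_def)
  also have "\<dots> = (if grng G (ginv G c) \<in> Z then star f (ginv G c) else 0)"
    using convolution_indicator_units[OF compact_bisection_local[OF Z(1)] Z(2) inv_closed[OF c]] .
  finally show ?thesis using c by (simp add: star_def inv_closed inv_inv rng_inv)
qed

lemma effective_ideal_indicator:
  fixes I :: "('a \<Rightarrow> 'k::field) set"
  assumes eff: "effective_groupoid G" and sing: "(singular_functions G :: ('a \<Rightarrow> 'k) set) = {0}"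
    and I: "two_sided_ideal (convolution G) (steinberg_algebra G) I" "I \<noteq> {0}"
  shows "\<exists>Z. compact_bisection Z \<and> Z \<noteq> {} \<and> Z \<subseteq> units G \<and> indicator Z \<in> I"
proof -
  have sub: "fun_module.subspace I" and IA: "I \<subseteq> steinberg_algebra G"
    and l: "\<And>f g. f \<in> steinberg_algebra G \<Longrightarrow> g \<in> I \<Longrightarrow> convolution G f g \<in> I"
    and r: "\<And>f g. f \<in> steinberg_algebra G \<Longrightarrow> g \<in> I \<Longrightarrow> convolution G g f \<in> I"
    using I(1) unfolding two_sided_ideal_def by auto
  obtain f where f: "f \<in> I" "f \<noteq> 0" using I(2) fun_module.subspace_0[OF sub] by blast
  have fA: "f \<in> steinberg_algebra G" using f(1) IA by blast
  have "f \<notin> singular_functions G" using sing f(2) by blast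
  then obtain W where W: "openin (gtop G) W" "W \<noteq> {}" "\<forall>x\<in>W. f x \<noteq> 0"
    using fA unfolding singular_iff by auto
  obtain V k where V: "openin (gtop G) V" "V \<noteq> {}" "V \<subseteq> W" "\<forall>x\<in>V. f x = k"
    using steinberg_constant_on_open[OF fA W(1,2)] by (elim exE conjE)
  obtain g where g: "g \<in> V" using V by blast
  then have k: "k \<noteq> 0" using V W(3) by (metis subsetD)
  obtain U where U: "compact_bisection U" "g \<in> U" "U \<subseteq> V" using compact_bisection_nbhd V g by metis
  \<comment> \<open>Translation by U^-1 moves the bisection U, where f equals k, onto the units
    d(U). The translate may still be non-zero at many arrows that are not units.\<close>
  let ?h = "convolution G (indicator (ginv G ` U)) f"
  have h: "?h \<in> I" using l f(1) steinberg_indicator[OF compact_bisection_inv[OF U(1)]] by blast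
  have hA: "?h \<in> steinberg_algebra G" using h IA by blast
  have hk: "?h u = k" if u: "u \<in> gdom G ` U" for u
  proof -
    obtain a where a: "a \<in> U" "u = gdom G a" using u by blast
    have aa: "a \<in> arrows G" using a U compact_bisection_local local_bisection_arrows by blast
    have "?h u = f (gmult G (ginv G (ginv G a)) u)"
      using a aa by (intro convolution_indicator local_bisection_inv compact_bisection_local U)
        (auto simp: dom_closed rng_inv rng_dom)
    also have "\<dots> = k" using a aa U(3) V(4) by (auto simp: inv_inv mult_dom)
    finally show ?thesis .
  qed
  obtain F where F: "finite F" "\<forall>U\<in>F. compact_bisection U" "{g. ?h g \<noteq> 0} \<subseteq> \<Union>F"
    using steinberg_support[OF hA] by blast
  have D: "openin (unit_space G) (gdom G ` U)" "gdom G ` U \<noteq> {}"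
    using compact_bisection_dom[OF U(1)] compact_bisection_units U(2) by blast+
  obtain Z1 where Z1: "openin (unit_space G) Z1" "Z1 \<noteq> {}" "Z1 \<subseteq> gdom G ` U"
    "\<forall>g\<in>\<Union>F. gdom G g \<in> Z1 \<and> grng G g \<in> Z1 \<longrightarrow> g \<in> units G"
    using effective_shrink_finite[OF eff F(1) _ D] F(2) compact_bisection_local by blast
  obtain x where "x \<in> Z1" using Z1 by blast
  then obtain Z where Z: "compact_bisection Z" "x \<in> Z" "Z \<subseteq> Z1" "Z \<subseteq> units G"
    using compact_open_nbhd_unit Z1(1) by metis
  let ?z = "indicator Z :: 'a \<Rightarrow> 'k"
  let ?e = "convolution G ?z (convolution G ?h ?z)"
  have zA: "?z \<in> steinberg_algebra G" using Z(1) by (rule steinberg_indicator)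
  have eI: "?e \<in> I" using l[OF zA r[OF zA h]] .
  have "?e c = k * ?z c" for c
  proof (cases "c \<in> arrows G")
    case False
    then have "c \<notin> Z" using Z(4) units_arrows by blast
    then show ?thesis using False by (simp add: convolution_outside)
  next
    case True
    \<comment> \<open>The left factor keeps the arrows ending in Z, the right factor those starting
      in Z.\<close>
    have e: "?e c = (if grng G c \<in> Z then if gdom G c \<in> Z then ?h c else 0 else 0)"
      unfolding convolution_indicator_units[OF compact_bisection_local[OF Z(1)] Z(4) True]
        convolution_indicator_units_right[OF hA Z(1,4) True] ..
    show ?thesis
    proof (cases "c \<in> Z")
      case True
      then have "gdom G c = c" "grng G c = c" using Z(4) dom_unit rng_unit by auto
      moreover have "?h c = k" using hk True Z(3) Z1(3) by blast
      ultimately show ?thesis using e True by simp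
    next
      case False
      have "?h c = 0" if "grng G c \<in> Z" "gdom G c \<in> Z"
      proof (rule ccontr)
        assume "?h c \<noteq> 0"
        then have "c \<in> \<Union>F" using F(3) by blast
        \<comment> \<open>By the choice of Z1 an arrow of the support with both ends in Z is a unit;
          being its own domain, it then lies in Z.\<close>
        then have "c \<in> units G" using Z1(4) that Z(3) by blast
        then show False using that(2) False dom_unit by simp
      qed
      then show ?thesis using e False by simp
    qed
  qed
  \<comment> \<open>Division by k is where the coefficients being a field is used.\<close>
  then have "?z = fun_scale (inverse k) ?e" using k by (auto simp: fun_scale_def fun_eq_iff)
  then have "?z \<in> I" using fun_module.subspace_scale[OF sub eI, of "inverse k"] by (simp only:)
  then show ?thesis using Z by blast
qed

lemma minimal_ideal_indicator:
  fixes I :: "('a \<Rightarrow> 'k::field) set"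
  assumes min: "minimal_groupoid G"
    and I: "two_sided_ideal (convolution G) (steinberg_algebra G) I"
    and Z: "compact_bisection Z" "Z \<noteq> {}" "Z \<subseteq> units G" "indicator Z \<in> I"
    and x: "x \<in> units G"
  shows "\<exists>N. compact_bisection N \<and> N \<subseteq> units G \<and> x \<in> N \<and> indicator N \<in> I"
proof -
  have l: "convolution G f g \<in> I" if "f \<in> steinberg_algebra G" "g \<in> I" for f g
    using I that unfolding two_sided_ideal_def by auto
  have r: "convolution G g f \<in> I" if "f \<in> steinberg_algebra G" "g \<in> I" for f g
    using I that unfolding two_sided_ideal_def by auto
  have "unit_space G closure_of orbit G x = topspace (unit_space G)"
    using min x by (simp add: minimal_groupoid_def topspace_unit_space)
  moreover have Zo: "openin (unit_space G) Z" using Z compact_bisection_units by blast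
  ultimately have "Z \<inter> orbit G x \<noteq> {}" using Z(2) by (auto simp: dense_intersects_open)
  then obtain g where g: "g \<in> arrows G" "gdom G g = x" "grng G g \<in> Z" by (auto simp: orbit_def)
  let ?W = "{a \<in> arrows G. grng G a \<in> Z}"
  have "openin (gtop G) ?W"
    using openin_continuous_map_preimage[OF continuous_rng Zo] by (simp add: arrows_def)
  then obtain B where B: "compact_bisection B" "g \<in> B" "B \<subseteq> ?W"
    using compact_bisection_nbhd[of ?W g] g by blast
  have Bl: "local_bisection G B" and Ba: "B \<subseteq> arrows G" using B compact_bisection_local by auto
  \<comment> \<open>All ranges of B lie in Z, so the indicator of Z is a left identity for that of
    B, which therefore belongs to the ideal.\<close>
  have "convolution G (indicator Z) (indicator B) c = (indicator B c :: 'k)" for c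
  proof (cases "c \<in> arrows G")
    case True
    show ?thesis
      unfolding convolution_indicator_units[OF compact_bisection_local[OF Z(1)] Z(3) True]
      using B(3) by (auto simp: indicator_def)
  next
    case False
    then have "c \<notin> B" using Ba by blast
    then show ?thesis using False by (simp add: convolution_outside)
  qed
  then have "convolution G (indicator Z) (indicator B) = (indicator B :: 'a \<Rightarrow> 'k)" by blast
  then have BI: "(indicator B :: 'a \<Rightarrow> 'k) \<in> I" using r[OF steinberg_indicator[OF B(1)] Z(4)] by simp
  \<comment> \<open>Injectivity of r on B pairs each arrow only with its own inverse. Multiplying by
    B^-1 thus carries the ideal element to the domain side, where x lies.\<close>
  have "setmult (ginv G ` B) B = gdom G ` B"
  proof (intro set_eqI iffI)
    fix c assume "c \<in> setmult (ginv G ` B) B"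
    then obtain a b where ab: "a \<in> B" "b \<in> B" "gdom G (ginv G a) = grng G b" "c = gmult G (ginv G a) b"
      by (auto simp: setmult_def)
    then have "a = b" using local_bisection_rngD[OF Bl, of a b] Ba by (auto simp: dom_inv)
    then show "c \<in> gdom G ` B" using ab Ba by (auto simp: inv_mult)
  next
    fix c assume "c \<in> gdom G ` B"
    then obtain a where "a \<in> B" "c = gdom G a" by blast
    then show "c \<in> setmult (ginv G ` B) B"
      using setmultI[of "ginv G a" "ginv G ` B" a B] Ba by (auto simp: inv_mult dom_inv)
  qed
  then have "convolution G (indicator (ginv G ` B)) (indicator B) = (indicator (gdom G ` B) :: 'a \<Rightarrow> 'k)"
    using convolution_indicators[OF local_bisection_inv[OF Bl] Ba] by simp
  then have "(indicator (gdom G ` B) :: 'a \<Rightarrow> 'k) \<in> I"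
    using l[OF steinberg_indicator[OF compact_bisection_inv[OF B(1)]] BI] by simp
  then show ?thesis using compact_bisection_dom[OF B(1)] B(2) g(2) by blast
qed

text \<open>Inclusion-exclusion: on sets of units convolution is the pointwise product, so the
  correction term is a product with an element of the ideal.\<close>

lemma ideal_indicator_Un:
  fixes I :: "('a \<Rightarrow> 'k::field) set"
  assumes I: "two_sided_ideal (convolution G) (steinberg_algebra G) I"
    and N: "compact_bisection N" "N \<subseteq> units G" "indicator N \<in> I"
    and M: "compact_bisection M" "M \<subseteq> units G" "indicator M \<in> I"
  shows "compact_bisection (N \<union> M)" "(indicator (N \<union> M) :: 'a \<Rightarrow> 'k) \<in> I"
proof -
  have "openin (unit_space G) (N \<union> M) \<and> compactin (unit_space G) (N \<union> M)"
    using N M compact_bisection_units compactin_Un openin_Un by meson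
  then show "compact_bisection (N \<union> M)" using compact_bisection_units by blast
  have sub: "fun_module.subspace I" using I unfolding two_sided_ideal_def by blast
  let ?n = "indicator N :: 'a \<Rightarrow> 'k" and ?m = "indicator M :: 'a \<Rightarrow> 'k"
  have c: "convolution G ?n ?m \<in> I"
    using I M(3) steinberg_indicator[OF N(1)] unfolding two_sided_ideal_def by blast
  have "convolution G ?n ?m c = ?n c * ?m c" for c
  proof (cases "c \<in> arrows G")
    case True
    show ?thesis
      unfolding convolution_indicator_units[OF compact_bisection_local[OF N(1)] N(2) True]
      using rng_unit[of c] M(2) N(2) rng_in_units[OF True] by (auto simp: indicator_def subset_iff)
  next
    case False
    then have "c \<notin> N" using N(2) units_arrows by blast
    then show ?thesis using False by (simp add: convolution_outside)
  qed
  then have "indicator (N \<union> M) = ?n + ?m - convolution G ?n ?m"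
    by (auto simp: fun_eq_iff indicator_def)
  then show "(indicator (N \<union> M) :: 'a \<Rightarrow> 'k) \<in> I"
    using fun_module.subspace_diff[OF sub fun_module.subspace_add[OF sub N(3) M(3)] c] by (simp only:)
qed

lemma minimal_effective_imp_simple:
  assumes min: "minimal_groupoid G" and eff: "effective_groupoid G"
    and sing: "(singular_functions G :: ('a \<Rightarrow> 'k::field) set) = {0}"
    and ne: "arrows G \<noteq> {}"
  shows "simple_algebra (convolution G) (steinberg_algebra G :: ('a \<Rightarrow> 'k) set)"
  unfolding simple_algebra_def
proof (intro conjI allI impI)
  obtain x where "x \<in> units G" using ne dom_in_units by blast
  then obtain Z where Z: "compact_bisection Z" "x \<in> Z" using unit_nbhd by blast
  then have "(indicator Z x :: 'k) \<noteq> 0" by simp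
  then have "(indicator Z :: 'a \<Rightarrow> 'k) \<noteq> 0" by (metis zero_fun_apply)
  then show "steinberg_algebra G \<noteq> ({0} :: ('a \<Rightarrow> 'k) set)" using steinberg_indicator[OF Z(1)] by blast
next
  fix I :: "('a \<Rightarrow> 'k) set"
  assume I: "two_sided_ideal (convolution G) (steinberg_algebra G) I"
  show "I = {0} \<or> I = steinberg_algebra G"
  proof (cases "I = {0}")
    case False
    have sub: "fun_module.subspace I" and IA: "I \<subseteq> steinberg_algebra G"
      using I unfolding two_sided_ideal_def by blast+
    have left: "convolution G f g \<in> I" if "f \<in> steinberg_algebra G" "g \<in> I" for f g
      using I that unfolding two_sided_ideal_def by auto
    obtain Z where Z: "compact_bisection Z" "Z \<noteq> {}" "Z \<subseteq> units G" "indicator Z \<in> I"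
      using effective_ideal_indicator[OF eff sing I False] by blast
    let ?P = "\<lambda>N. compact_bisection N \<and> N \<subseteq> units G \<and> (indicator N :: 'a \<Rightarrow> 'k) \<in> I"
    have union: "?P (\<Union>F)" if "finite F" "\<forall>N\<in>F. ?P N" for F
      using that
    proof (induction rule: finite_induct)
      case empty
      have "compact_bisection {}"
        using compact_bisection_units[of "{}"] by simp
      moreover have "(indicator {} :: 'a \<Rightarrow> 'k) = 0" by (auto simp: fun_eq_iff)
      then have "(indicator {} :: 'a \<Rightarrow> 'k) \<in> I" using fun_module.subspace_0[OF sub] by (simp only:)
      ultimately show ?case unfolding Union_empty by blast
    next
      case (insert N F)
      then have N: "?P N" and F: "?P (\<Union>F)" by simp_all
      then show ?case using ideal_indicator_Un[OF I, of N "\<Union>F"] by simp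
    qed
    have gen: "(indicator U :: 'a \<Rightarrow> 'k) \<in> I" if U: "compact_bisection U" for U
    proof -
      have Ua: "U \<subseteq> arrows G" using U compact_bisection_local local_bisection_arrows by blast
      have "compactin (unit_space G) (gdom G ` U)"
        using compact_bisection_dom[OF U] compact_bisection_units by blast
      moreover have "\<forall>N\<in>{N. ?P N}. openin (unit_space G) N" using compact_bisection_units by blast
      moreover have "gdom G ` U \<subseteq> \<Union>{N. ?P N}"
        using minimal_ideal_indicator[OF min I Z] compact_bisection_dom(2)[OF U] by blast
      ultimately obtain F where F: "finite F" "F \<subseteq> {N. ?P N}" "gdom G ` U \<subseteq> \<Union>F"
        \<comment> \<open>Compactness of d(U) replaces the neighbourhoods of its individual units by
          one finite union, whose indicator acts as a right identity on that of U.\<close>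
        unfolding compactin_def by meson
      then have P: "?P (\<Union>F)" using union by blast
      have "setmult U (\<Union>F) = U"
      proof (intro set_eqI iffI)
        fix c assume "c \<in> setmult U (\<Union>F)"
        then obtain a b where ab: "a \<in> U" "b \<in> \<Union>F" "gdom G a = grng G b" "c = gmult G a b"
          unfolding setmult_def by blast
        then have "b = gdom G a" using P rng_unit[of b] by auto
        then show "c \<in> U" using ab Ua by (auto simp: mult_dom)
      next
        fix a assume a: "a \<in> U"
        then have "gdom G a \<in> \<Union>F" "gdom G a = grng G (gdom G a)" "gmult G a (gdom G a) = a"
          using F(3) Ua by (auto simp: rng_dom mult_dom)
        then show "a \<in> setmult U (\<Union>F)" using setmultI[OF a] by metis
      qed
      moreover have "\<Union>F \<subseteq> arrows G" using P units_arrows by blast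
      ultimately have "convolution G (indicator U) (indicator (\<Union>F)) = (indicator U :: 'a \<Rightarrow> 'k)"
        using convolution_indicators[OF compact_bisection_local[OF U]] by metis
      moreover have "convolution G (indicator U) (indicator (\<Union>F)) \<in> I"
        by (rule left) (use P steinberg_indicator[OF U] in blast)+
      ultimately show ?thesis by simp
    qed
    have "f \<in> I" if "f \<in> steinberg_algebra G" for f
      using that
    proof (induction rule: steinberg_induct)
      case zero
      show ?case by (rule fun_module.subspace_0[OF sub])
    next
      case (indicator U)
      then show ?case by (rule gen)
    next
      case (add f g)
      show ?case by (rule fun_module.subspace_add[OF sub add.IH])
    next
      case (scale c f)
      show ?case by (rule fun_module.subspace_scale[OF sub scale.IH])
    qed
    then show ?thesis using IA by blast
  qed simp
qed

end

theorem theoremA: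
  fixes G :: "'a tgroupoid"
  assumes "ample_groupoid G"
    and "arrows G \<noteq> {}"
  shows "simple_algebra (convolution G) (steinberg_algebra G :: ('a \<Rightarrow> 'k::field) set) \<longleftrightarrow>
    minimal_groupoid G \<and> effective_groupoid G \<and>
    (singular_functions G :: ('a \<Rightarrow> 'k) set) = {0}"
proof -
  interpret ample_groupoid G by (rule assms(1))
  show ?thesis
    using simple_imp_minimal simple_imp_effective simple_imp_singular_zero[OF _ assms(2)]
      minimal_effective_imp_simple[OF _ _ _ assms(2)] by blast
qed

end
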